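(* Consider scale-free percolation (SFP) on $\mathbb{Z}^d$ with parameters $\alpha\in(1,2)$, $\tau>3$ and $\lambda>0$. Then for every sufficiently small $\varepsilon>0$ there is a constant $c>0$ such that $$\lim_{|x-y|\to\infty}\mathbb{P}\left(d_G(x,y)\ge c\,\bigl(\log|x-y|\bigr)^{\Delta(\min\{\alpha,\tau-2-\varepsilon\})}\right)=1.$$
   Context: Scale-free percolation (SFP) with parameters $d\ge 1$, $\alpha>1$, $\tau>1$, $\lambda>0$: the vertex set is $\mathbb{Z}^d$, and $|\cdot|$ is the Euclidean norm. Each vertex $x$ independently draws a weight $w_x$ with $\mathbb{P}(w_x\ge z)=z^{1-\tau}$ for $z\ge1$. All nearest-neighbour grid edges of $\mathbb{Z}^d$ are present. In addition, conditionally on the weights, each pair $x\ne y$ is joined independently by a (long-range) edge with probability $\min\{1,\lambda(w_xw_y/|x-y|^d)^{\alpha}\}$. $d_G(x,y)$ is the graph distance in the resulting random graph $G$. For $\beta\in(1,2)$, $\Delta(\beta)=1/\log_2(2/\beta)$. The limit is over pairs $x,y\in\mathbb{Z}^d$ whose Euclidean distance tends to infinity. *)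

theory Defs
  imports "HOL-Probability.Probability" "HOL-Library.Extended_Nat"
begin

definition eucl :: "int ^ 'd \<Rightarrow> int ^ 'd \<Rightarrow> real" where
  "eucl x y = norm ((\<chi> i. real_of_int (x $ i - y $ i)) :: real ^ 'd)"

definition grid_edges :: "(int ^ 'd) rel" where
  "grid_edges = {(x, y). eucl x y = 1}"

definition conn_prob ::
  "real \<Rightarrow> real \<Rightarrow> (int ^ 'd \<Rightarrow> real) \<Rightarrow> int ^ 'd \<Rightarrow> int ^ 'd \<Rightarrow> real" where
  "conn_prob \<alpha> l w x y = min 1 (l * ((w x * w y) / eucl x y ^ CARD('d)) powr \<alpha>)"

text \<open>
  The infimum over the lengths of all walks from \<open>x\<close> to \<open>y\<close>; it is \<open>\<infinity>\<close> if there is none.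
\<close>

definition graph_dist :: "'v rel \<Rightarrow> 'v \<Rightarrow> 'v \<Rightarrow> enat" where
  "graph_dist E x y = (INF n \<in> {n. (x, y) \<in> E ^^ n}. enat n)"

definition weight_algebra :: "'a measure \<Rightarrow> ('v \<Rightarrow> 'a \<Rightarrow> real) \<Rightarrow> 'a measure" where
  "weight_algebra M W = vimage_algebra (space M) (\<lambda>\<omega> x. W x \<omega>) (Pi\<^sub>M UNIV (\<lambda>_. borel))"

text \<open>
  \<open>W x\<close> is the weight of the vertex \<open>x\<close>, and \<open>L \<omega>\<close> is the set of long-range edges; an undirected
  edge is represented by both of its orientations. In \<open>cond_edges\<close>, the requirement that \<open>F\<close> be
  asymmetric means that \<open>F\<close> contains no loop and every unordered pair at most once. That the
  conditional probability of the joint presence factorises over all such finite \<open>F\<close> expresses both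
  the conditional edge probabilities (singleton \<open>F\<close>) and conditional independence of the edges
  given the weights.
\<close>

locale scale_free_percolation = prob_space M
  for M :: "'a measure" +
  fixes W :: "int ^ 'd \<Rightarrow> 'a \<Rightarrow> real"
    and L :: "'a \<Rightarrow> (int ^ 'd) rel"
    and \<alpha> \<tau> l :: real
  assumes alpha_gt_1: "\<alpha> > 1"
    and tau_gt_1: "\<tau> > 1"
    and l_pos: "l > 0"
    and indep_weights: "indep_vars (\<lambda>_. borel) W UNIV"
    and weight_tail: "\<And>x z. z \<ge> 1 \<Longrightarrow> prob {\<omega> \<in> space M. W x \<omega> \<ge> z} = z powr (1 - \<tau>)"
    and edges_sym: "\<And>\<omega>. \<omega> \<in> space M \<Longrightarrow> sym (L \<omega>)"
    and edges_irrefl: "\<And>\<omega>. \<omega> \<in> space M \<Longrightarrow> irrefl (L \<omega>)"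
    and edges_measurable: "\<And>x y. {\<omega> \<in> space M. (x, y) \<in> L \<omega>} \<in> events"
    and cond_edges: "\<And>F. finite F \<Longrightarrow> asym F \<Longrightarrow>
      AE \<omega> in M. real_cond_exp M (weight_algebra M W) (indicator {\<omega> \<in> space M. F \<subseteq> L \<omega>}) \<omega>
        = (\<Prod>(x, y)\<in>F. conn_prob \<alpha> l (\<lambda>v. W v \<omega>) x y)"

definition sfp_graph :: "('a \<Rightarrow> (int ^ 'd) rel) \<Rightarrow> 'a \<Rightarrow> (int ^ 'd) rel" where
  "sfp_graph L \<omega> = grid_edges \<union> L \<omega>"

definition \<Delta> :: "real \<Rightarrow> real" where
  "\<Delta> \<beta> = 1 / log 2 (2 / \<beta>)"

definition far_pairs :: "((int ^ 'd) \<times> (int ^ 'd)) filter" where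
  "far_pairs = filtercomap (\<lambda>(x, y). eucl x y) at_top"

end

theory Submission
  imports Defs
begin

text \<open>
  If the graph distance of \<open>x\<close> and \<open>y\<close> is small, then some self-avoiding walk with few edges leads from
  \<open>x\<close> to \<open>y\<close>. The proof is a first moment bound. It cannot run over all walks, whose number is
  exponential in their length; it runs over \<^emph>\<open>skeletons\<close>, which remember only some long edges of a
  walk. Radii \<open>R n\<close> are fixed in advance. The skeleton of a walk with \<open>n\<close> edges is empty if
  \<open>|x - y| \<le> R n\<close>. Otherwise the walk has an edge of length at least \<open>|x - y| / n\<close>. The skeleton contains
  this long edge, the two edges next to it unless they belong to the grid, and skeletons of the two
  remaining pieces of the walk.

  Edges that share a vertex of large weight are positively correlated, and this has to be paid for.
  Given the weights, the edge \<open>uv\<close> is present with probability at most a constant times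
  \<open>(w\<^sub>u w\<^sub>v / |u - v|\<^sup>d)\<^bsup>\<theta>\<^esup>\<close>, for any exponent \<open>0 \<le> \<theta> \<le> \<alpha>\<close>. The expectation of a product of such bounds is
  finite if at each vertex the exponents of the incident edges add up to less than \<open>\<tau> - 1\<close>. The long
  edges get the exponent \<open>\<beta> = min \<alpha> (\<tau> - 2 - \<epsilon>)\<close>, and their neighbours only \<open>\<eta> = 1 + \<epsilon> / 2\<close>. As a
  skeleton contains no two adjacent long edges (\<open>skeleton_of_path\<close>), the sums are at most
  \<open>\<beta> + \<eta> < \<tau> - 1\<close>, and the probability of a skeleton is at most the product of \<open>A * |u - v|\<^bsup>-d\<theta>\<^esup>\<close>
  over its edges (\<open>emeasure_admissible_le\<close>). The neighbours of long edges are harmless, since an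
  exponent above \<open>1\<close> is already summable over the lattice.

  The sum of these products over all skeletons obeys a recursion: for \<open>|x - y| > R n\<close> it is at most
  a constant times \<open>(n / |x - y|)\<^bsup>d\<beta>\<^esup>\<close> times the sum of \<open>(R m * R m')\<^sup>d\<close> over \<open>m + m' + 1 = n\<close>. It
  therefore stays below \<open>(R n / |x - y|)\<^bsup>d\<beta>\<^esup>\<close> if \<open>(R n)\<^bsup>\<beta>\<^esup>\<close> dominates \<open>R m * R m'\<close> up to polynomial
  factors (\<open>skeleton_mass_le\<close>). The critical case is \<open>m = m'\<close>, which leads to radii with
  \<open>ln (R n)\<close> of order \<open>n\<^sup>s\<close>, where \<open>2 * (1/2)\<^sup>s = \<beta>\<close>, that is, \<open>s = 1 / \<Delta> \<beta>\<close> (\<open>radii_exist\<close>). For \<open>n\<close> up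
  to a small multiple of \<open>(ln |x - y|)\<^bsup>\<Delta> \<beta>\<^esup>\<close> the radius is at most the square root of \<open>|x - y|\<close>, and
  the sum of the bounds over these \<open>n\<close> tends to zero.
\<close>

section \<open>Sums over the lattice\<close>

lemma card_lattice_ball:
  fixes x :: "int ^ 'd"
  assumes "\<rho> \<ge> 0"
  shows "finite {y. eucl x y \<le> \<rho>}" "real (card {y. eucl x y \<le> \<rho>}) \<le> (2 * \<rho> + 1) ^ CARD('d)"
proof -
  let ?m = "\<lfloor>\<rho>\<rfloor>"
  let ?P = "PiE UNIV (\<lambda>i. {x $ i - ?m .. x $ i + ?m})"
  have fin: "finite ?P" by (intro finite_PiE) auto
  have sub: "vec_nth ` {y. eucl x y \<le> \<rho>} \<subseteq> ?P"
  proof (rule image_subsetI, rule PiE_I)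
    fix y i assume "y \<in> {y. eucl x y \<le> \<rho>}"
    then have "eucl x y \<le> \<rho>" by simp
    moreover have "\<bar>real_of_int (x $ i - y $ i)\<bar> \<le> eucl x y"
      unfolding eucl_def using component_le_norm_cart[of "(\<chi> i. real_of_int (x $ i - y $ i)) :: real ^ 'd" i] by simp
    ultimately have "\<bar>real_of_int (x $ i - y $ i)\<bar> \<le> \<rho>" by linarith
    then have "\<bar>x $ i - y $ i\<bar> \<le> ?m" by (simp add: le_floor_iff)
    then show "y $ i \<in> {x $ i - ?m .. x $ i + ?m}" by auto
  qed simp
  have inj: "inj_on vec_nth {y. eucl x y \<le> \<rho>}" by (simp add: inj_on_def vec_nth_inject)
  show "finite {y. eucl x y \<le> \<rho>}" using finite_imageD[OF finite_subset[OF sub fin] inj] .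
  have "card {y. eucl x y \<le> \<rho>} \<le> card ?P"
    using card_inj_on_le[OF inj sub fin] .
  also have "card ?P = nat (2 * ?m + 1) ^ CARD('d)"
    by (subst card_PiE) (auto simp: algebra_simps)
  finally have "real (card {y. eucl x y \<le> \<rho>}) \<le> real (nat (2 * ?m + 1)) ^ CARD('d)"
    by (metis of_nat_le_iff of_nat_power)
  also have "\<dots> \<le> (2 * \<rho> + 1) ^ CARD('d)"
    using assms by (intro power_mono) (auto simp: le_floor_iff)
  finally show "real (card {y. eucl x y \<le> \<rho>}) \<le> (2 * \<rho> + 1) ^ CARD('d)" .
qed

lemma eucl_commute: "eucl x y = eucl y x"
proof -
  have "(\<chi> i. real_of_int (x $ i - y $ i)) = - (\<chi> i. real_of_int (y $ i - x $ i))"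
    by (simp add: vec_eq_iff)
  then show ?thesis unfolding eucl_def by (metis norm_minus_cancel)
qed

lemma eucl_triangle: "eucl x z \<le> eucl x y + eucl y z"
proof -
  have "(\<chi> i. real_of_int (x $ i - z $ i)) = (\<chi> i. real_of_int (x $ i - y $ i)) + (\<chi> i. real_of_int (y $ i - z $ i))"
    by (simp add: vec_eq_iff)
  then show ?thesis unfolding eucl_def by (metis norm_triangle_ineq)
qed

lemma eucl_nonneg [simp]: "0 \<le> eucl x y"
  by (simp add: eucl_def)

lemma eucl_self [simp]: "eucl x x = 0"
  by (simp add: eucl_def vec_eq_iff zero_vec_def[symmetric])

lemma eucl_ge_1: assumes "x \<noteq> y" shows "1 \<le> eucl x y"
proof -
  obtain i where i: "x $ i \<noteq> y $ i" using assms by (auto simp: vec_eq_iff)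
  then have "1 \<le> \<bar>x $ i - y $ i\<bar>" by linarith
  then have "1 \<le> \<bar>real_of_int (x $ i - y $ i)\<bar>" by linarith
  also have "\<dots> \<le> eucl x y"
    unfolding eucl_def using component_le_norm_cart[of "(\<chi> i. real_of_int (x $ i - y $ i))" i] by simp
  finally show ?thesis .
qed

text \<open>
  The shape of all connection bounds below: trivial up to distance \<open>R\<close>, and a power law beyond it.
\<close>

definition decay :: "real \<Rightarrow> real \<Rightarrow> real \<Rightarrow> real" where
  "decay p R r = (if r \<le> R then 1 else (R / r) powr p)"

lemma decay_nonneg [simp]: "0 \<le> decay p R r"
  by (simp add: decay_def)

text \<open>
  Cutting the range of distances at the radii \<open>2\<^sup>n * R\<close> reduces sums of \<open>decay\<close> over the lattice
  to counting points in balls.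
\<close>

lemma decay_le_shells:
  assumes "R \<ge> 1" "p > 0"
  shows "ennreal (decay p R r) \<le> (\<Sum>n. ennreal (2 powr (p * (1 - real n))) * indicator {r. r \<le> 2 ^ n * R} r)"
proof -
  have "\<exists>n. r \<le> 2 ^ n * R"
  proof -
    obtain n where "r < 2 ^ n" using real_arch_pow[of 2 r] by auto
    moreover have "(2::real) ^ n * 1 \<le> 2 ^ n * R" using assms by (intro mult_left_mono) auto
    ultimately show ?thesis by (intro exI[of _ n]) linarith
  qed
  define n where "n = (LEAST n. r \<le> 2 ^ n * R)"
  have n: "r \<le> 2 ^ n * R" unfolding n_def using \<open>\<exists>n. r \<le> 2 ^ n * R\<close> by (rule LeastI_ex)
  have le: "decay p R r \<le> 2 powr (p * (1 - real n))"
  proof (cases n)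
    case 0
    have "decay p R r = 1" using n 0 by (simp add: decay_def)
    also have "1 \<le> 2 powr (p * (1 - real n))" using 0 assms by (simp add: ge_one_powr_ge_zero)
    finally show ?thesis .
  next
    case (Suc m)
    have "\<not> r \<le> 2 ^ m * R" using not_less_Least[of m "\<lambda>n. r \<le> 2 ^ n * R"] Suc unfolding n_def by simp
    then have r: "2 ^ m * R < r" by simp
    moreover have "(0::real) < 2 ^ m * R" using assms by simp
    moreover have "R \<le> 2 ^ m * R" using assms by simp
    ultimately have r': "r > 0" "r > R" by linarith+
    have "(R / r) powr p \<le> (2 powr (- real m)) powr p"
    proof (rule powr_mono2)
      have "R \<le> r / 2 ^ m" using r by (simp add: field_simps)
      then have "R / r \<le> 1 / 2 ^ m" using r' assms by (simp add: field_simps)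
      then show "R / r \<le> 2 powr - real m" by (simp add: powr_minus powr_realpow field_simps)
    qed (use assms r' in auto)
    also have "\<dots> = 2 powr (p * (1 - real n))" by (simp add: powr_powr Suc algebra_simps)
    finally show ?thesis using r' by (simp add: decay_def)
  qed
  let ?f = "\<lambda>n. ennreal (2 powr (p * (1 - real n))) * indicator {r. r \<le> 2 ^ n * R} r"
  have "ennreal (decay p R r) \<le> ?f n"
    using le n by (simp add: ennreal_leI)
  also have "\<dots> = sum ?f {n}" by (subst sum.insert) auto
  also have "\<dots> \<le> (\<Sum>n. ?f n)" by (intro sum_le_suminf summableI) auto
  finally show ?thesis .
qed

text \<open>
  The shell of radius \<open>2\<^sup>n * R\<close> has about \<open>(2\<^sup>n * R)\<^sup>d\<close> points, and \<open>p > d\<close> makes the resulting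
  series geometric. The bound says that a power law with exponent above \<open>d\<close> contributes no more than
  the ball on which it is truncated.
\<close>

lemma decay_sum_bounded:
  assumes "p > real CARD('d)"
  obtains C where "C \<ge> 1" "\<And>x :: int ^ 'd. \<And>R. R \<ge> 1 \<Longrightarrow>
    (\<integral>\<^sup>+y. ennreal (decay p R (eucl x y)) \<partial>count_space UNIV) \<le> ennreal (C * R ^ CARD('d))"
proof -
  let ?d = "CARD('d)"
  define q where "q = 2 powr (real ?d - p)"
  have q: "0 < q" "q < 1" using assms unfolding q_def by (auto intro: powr_less_one)
  define C where "C = max 1 (2 powr p * 3 ^ ?d / (1 - q))"
  have "p > 0" using assms by (metis dual_order.strict_trans of_nat_0_le_iff order_le_less)
  have "(\<integral>\<^sup>+y. ennreal (decay p R (eucl x y)) \<partial>count_space UNIV) \<le> ennreal (C * R ^ CARD('d))"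
    if R: "R \<ge> 1" for x :: "int ^ 'd" and R
  proof -
    have "(\<integral>\<^sup>+y. ennreal (decay p R (eucl x y)) \<partial>count_space UNIV)
      \<le> (\<integral>\<^sup>+y. (\<Sum>n. ennreal (2 powr (p * (1 - real n))) * indicator {y. eucl x y \<le> 2 ^ n * R} y) \<partial>count_space UNIV)"
      using decay_le_shells[OF R \<open>p > 0\<close>] by (intro nn_integral_mono) (auto simp: indicator_def)
    also have "\<dots> = (\<Sum>n. ennreal (2 powr (p * (1 - real n))) * emeasure (count_space UNIV) {y. eucl x y \<le> 2 ^ n * R})"
      by (subst nn_integral_suminf) (auto simp: nn_integral_cmult)
    also have "\<dots> \<le> (\<Sum>n. ennreal (2 powr p * 3 ^ ?d * R ^ ?d * q ^ n))"
    proof (intro suminf_le allI summableI)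
      fix n
      have "emeasure (count_space UNIV) {y. eucl x y \<le> 2 ^ n * R} = ennreal (card {y. eucl x y \<le> 2 ^ n * R})"
        using card_lattice_ball(1)[of "2 ^ n * R" x] R by (simp add: emeasure_count_space ennreal_of_nat_eq_real_of_nat)
      also have "\<dots> \<le> ennreal ((3 * (2 ^ n * R)) ^ ?d)"
      proof (rule ennreal_leI)
        have "real (card {y. eucl x y \<le> 2 ^ n * R}) \<le> (2 * (2 ^ n * R) + 1) ^ ?d"
          by (rule card_lattice_ball) (use R in auto)
        also have "\<dots> \<le> (3 * (2 ^ n * R)) ^ ?d"
        proof (rule power_mono)
          have "1 * 1 \<le> 2 ^ n * R" using R by (intro mult_mono) auto
          then show "2 * (2 ^ n * R) + 1 \<le> 3 * (2 ^ n * R)" by linarith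
        qed (use R in auto)
        finally show "real (card {y. eucl x y \<le> 2 ^ n * R}) \<le> (3 * (2 ^ n * R)) ^ ?d" .
      qed
      finally have "ennreal (2 powr (p * (1 - real n))) * emeasure (count_space UNIV) {y. eucl x y \<le> 2 ^ n * R}
         \<le> ennreal (2 powr (p * (1 - real n))) * ennreal ((3 * (2 ^ n * R)) ^ ?d)"
        by (intro mult_left_mono) auto
      also have "\<dots> = ennreal (2 powr (p * (1 - real n)) * (3 * (2 ^ n * R)) ^ ?d)"
        by (simp add: ennreal_mult' flip: ennreal_mult)
      also have "2 powr (p * (1 - real n)) * (3 * (2 ^ n * R)) ^ ?d = 2 powr p * 3 ^ ?d * R ^ ?d * q ^ n"
      proof -
        have "2 powr (p * (1 - real n)) = 2 powr p * 2 powr (- p * real n)"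
          by (simp flip: powr_add) (simp add: algebra_simps)
        moreover have "(2::real) ^ (n * ?d) = 2 powr (real ?d * real n)"
          by (simp add: powr_realpow[symmetric] mult.commute)
        moreover have "q ^ n = 2 powr (- p * real n) * 2 powr (real ?d * real n)"
          by (simp add: q_def powr_realpow[symmetric] powr_powr flip: powr_add) (simp add: algebra_simps)
        ultimately show ?thesis by (simp add: power_mult_distrib power_mult)
      qed
      finally show "ennreal (2 powr (p * (1 - real n))) * emeasure (count_space UNIV) {y. eucl x y \<le> 2 ^ n * R}
         \<le> ennreal (2 powr p * 3 ^ ?d * R ^ ?d * q ^ n)" .
    qed
    also have "\<dots> = ennreal (2 powr p * 3 ^ ?d * R ^ ?d * (1 / (1 - q)))"
      using q R by (intro suminf_ennreal_eq sums_mult geometric_sums) auto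
    also have "\<dots> \<le> ennreal (C * R ^ ?d)"
    proof (rule ennreal_leI)
      have "2 powr p * 3 ^ ?d / (1 - q) * R ^ ?d \<le> C * R ^ ?d"
        using R by (intro mult_right_mono) (auto simp: C_def)
      then show "2 powr p * 3 ^ ?d * R ^ ?d * (1 / (1 - q)) \<le> C * R ^ ?d" by (simp add: field_simps)
    qed
    finally show ?thesis .
  qed
  then show ?thesis by (intro that[of C]) (auto simp: C_def)
qed

section \<open>Radii growing like a stretched exponential\<close>

lemma powr_sum_le:
  fixes x s :: real
  assumes "0 < s" "s < 1" "0 < x" "x < 1"
  shows "x powr s + (1 - x) powr s \<le> 2 powr (1 - s)"
proof -
  let ?p = "1 / s" and ?a = "x powr s" and ?b = "(1 - x) powr s"
  have cv: "convex_on {0<..} (\<lambda>x::real. x powr ?p)" using assms by (intro powr_convex) auto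
  have "((1 - 1/2) *\<^sub>R ?a + (1/2) *\<^sub>R ?b) powr ?p \<le> (1 - 1/2) * ?a powr ?p + (1/2) * ?b powr ?p"
    by (rule convex_onD[OF cv]) (use assms in auto)
  also have "\<dots> = 1 / 2" using assms by (simp add: powr_powr field_simps)
  finally have *: "((?a + ?b) / 2) powr ?p \<le> 1 / 2" by (simp add: field_simps)
  have "(?a + ?b) / 2 = (((?a + ?b) / 2) powr ?p) powr s" using assms by (simp add: powr_powr)
  also have "\<dots> \<le> (1 / 2) powr s" using * assms by (intro powr_mono2) auto
  also have "\<dots> = 2 powr (- s)" by (simp add: powr_divide powr_minus field_simps)
  finally show ?thesis by (simp add: powr_diff powr_minus field_simps)
qed

text \<open>
  Two parts \<open>x\<close> and \<open>1 - x\<close> of a unit length satisfy \<open>x\<^sup>s + (1 - x)\<^sup>s \<le> \<beta>\<close>, with equality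
  exactly at \<open>x = 1/2\<close>. There a smaller exponent \<open>t\<close> has a strictly larger sum, so that
  subtracting half of the power \<open>t\<close> leaves room everywhere; compactness makes the room uniform.
\<close>

lemma powr_gap:
  fixes \<beta> s t :: real
  assumes s: "0 < s" "s < 1" and \<beta>: "\<beta> = 2 powr (1 - s)" and t: "0 < t" "t < s"
  obtains c where "c > 0" "\<And>x. 0 \<le> x \<Longrightarrow> x \<le> 1 \<Longrightarrow>
      c \<le> \<beta> / 2 - (x powr s + (1 - x) powr s) + (x powr t + (1 - x) powr t) / 2"
proof -
  let ?G = "\<lambda>x::real. \<beta> / 2 - (x powr s + (1 - x) powr s) + (x powr t + (1 - x) powr t) / 2"
  have "\<beta> > 1" using s by (simp add: \<beta>)
  have pos: "?G x > 0" if x: "x \<in> {0..1}" for x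
  proof (cases "x = 0 \<or> x = 1")
    case True
    then show ?thesis using \<open>\<beta> > 1\<close> by auto
  next
    case False
    then have x': "0 < x" "x < 1" using x by auto
    have "x powr s < x powr t" "(1 - x) powr s < (1 - x) powr t"
      using x' t by (auto intro!: powr_less_mono')
    moreover have "x powr s + (1 - x) powr s \<le> \<beta>" using powr_sum_le[OF s x'] \<beta> by simp
    ultimately show ?thesis by (simp add: field_simps)
  qed
  have "continuous_on {0..1} ?G"
    using s t by (intro continuous_intros continuous_on_powr') auto
  then obtain x0 where x0: "x0 \<in> {0..1}" "\<And>x. x \<in> {0..1} \<Longrightarrow> ?G x0 \<le> ?G x"
    using continuous_attains_inf[of "{0..1::real}" ?G] by auto
  show ?thesis using pos[OF x0(1)] x0(2) by (intro that[of "?G x0"]) auto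
qed

text \<open>
  The radii that make the recursive estimate \<open>skeleton_mass_le\<close> close up. Up to logarithmic terms,
  \<open>ln R\<close> has to satisfy \<open>ln (R m) + ln (R m') \<le> \<beta> * ln (R n)\<close> for \<open>m + m' + 1 = n\<close>. The function
  \<open>N\<^sup>s\<close> of \<open>N = n + 1\<close> does so, by \<open>powr_sum_le\<close>, but with equality when \<open>m = m'\<close>. The correction
  \<open>- N\<^sup>t / 2\<close> of lower order gains a multiple of \<open>N\<^sup>t\<close>, which absorbs \<open>ln K + D * ln n\<close> once the
  whole function is multiplied by a large constant \<open>a\<close>.
\<close>

lemma radii_exist:
  fixes \<beta> s D d K :: real
  assumes s: "0 < s" "s < 1" and \<beta>: "\<beta> = 2 powr (1 - s)" and "d \<ge> 1" "D \<ge> 0" "K > 0"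
  obtains R :: "nat \<Rightarrow> real" and C :: real
  where "C > 0" "mono R" "\<And>n. R n \<ge> 1" "\<And>n. R n \<ge> real n"
    "\<And>m n. m < n \<Longrightarrow> K * real n powr D * (R m * R (n - 1 - m)) powr d \<le> R n powr (d * \<beta>)"
    "\<And>n. ln (R n) \<le> C * real (n + 1) powr s"
proof -
  define t where "t = s / 2"
  have t: "0 < t" "t < s" using s by (auto simp: t_def)
  obtain c where c: "c > 0" and gap: "\<And>x. 0 \<le> x \<Longrightarrow> x \<le> 1 \<Longrightarrow>
      c \<le> \<beta> / 2 - (x powr s + (1 - x) powr s) + (x powr t + (1 - x) powr t) / 2"
    by (rule powr_gap[OF s \<beta> t]) blast
  define \<phi> where "\<phi> x = x powr s - x powr t / 2" for x :: real
  have \<phi>_gap: "\<phi> p + \<phi> q + c * (p + q) powr t \<le> \<beta> * \<phi> (p + q)" if pq: "p \<ge> 1" "q \<ge> 1" for p q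
  proof -
    define N where "N = p + q"
    define x where "x = p / N"
    have N: "N \<ge> 1" using pq by (simp add: N_def)
    have x: "0 \<le> x" "x \<le> 1" using pq by (auto simp: x_def N_def field_simps)
    have pq': "p = N * x" "q = N * (1 - x)" using N by (auto simp: x_def N_def field_simps)
    have scaled: "p powr r = N powr r * x powr r" "q powr r = N powr r * (1 - x) powr r" for r
      unfolding pq' using N x by (simp_all add: powr_mult)
    let ?S = "x powr s + (1 - x) powr s" and ?T = "x powr t + (1 - x) powr t"
    have "?S \<le> \<beta>"
    proof (cases "x = 0 \<or> x = 1")
      case True
      have "1 \<le> \<beta>" unfolding \<beta> using s by (intro ge_one_powr_ge_zero) auto
      then show ?thesis using True by auto
    qed (use powr_sum_le[OF s, of x] x \<beta> in auto)
    have "c * N powr t \<le> (\<beta> / 2 - ?S + ?T / 2) * N powr t"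
      using gap[OF x] by (intro mult_right_mono) auto
    also have "\<dots> = (\<beta> - ?S) * N powr t - (\<beta> - ?T) * N powr t / 2" by (simp add: field_simps)
    also have "\<dots> \<le> (\<beta> - ?S) * N powr s - (\<beta> - ?T) * N powr t / 2"
      using \<open>?S \<le> \<beta>\<close> N t by (intro diff_mono mult_left_mono powr_mono) auto
    also have "\<dots> = \<beta> * \<phi> N - \<phi> p - \<phi> q"
      by (simp add: \<phi>_def scaled field_simps)
    finally show ?thesis by (simp add: N_def)
  qed
  have \<phi>_low: "x powr s / 2 \<le> \<phi> x" and \<phi>_up: "\<phi> x \<le> x powr s" if "x \<ge> 1" for x
    using powr_mono[of t s x] that t by (auto simp: \<phi>_def)
  have \<phi>_mono: "\<phi> x \<le> \<phi> y" if "1 \<le> x" "x \<le> y" for x y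
  proof -
    have eq: "\<phi> z = z powr t * (z powr (s - t) - 1 / 2)" if "z \<ge> 1" for z
      using that by (simp add: \<phi>_def right_diff_distrib flip: powr_add)
    have "1 \<le> x powr (s - t)" using that t by (intro ge_one_powr_ge_zero) auto
    then have "x powr t * (x powr (s - t) - 1 / 2) \<le> y powr t * (y powr (s - t) - 1 / 2)"
      using that t by (intro mult_mono diff_mono powr_mono2) auto
    then show ?thesis using that by (simp add: eq)
  qed
  \<comment> \<open>The first summand pays for \<open>K * n\<^sup>D\<close>, the second one for \<open>n \<le> R n\<close>.\<close>
  define a where "a = (\<bar>ln K\<bar> + D / t) / c + 2 / s"
  have a: "a * c \<ge> \<bar>ln K\<bar> + D / t" "a \<ge> 2 / s" "a > 0"
  proof -
    show "a * c \<ge> \<bar>ln K\<bar> + D / t" using c s by (simp add: a_def field_simps)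
    show "a \<ge> 2 / s" using c s t assms by (simp add: a_def)
    moreover have "2 / s > 0" using s by simp
    ultimately show "a > 0" by linarith
  qed
  define R where "R n = exp (a * \<phi> (real (n + 1)))" for n
  have R_ge_1: "R n \<ge> 1" for n
  proof -
    have "0 \<le> real (n + 1) powr s / 2" by simp
    also have "\<dots> \<le> \<phi> (real (n + 1))" by (rule \<phi>_low) simp
    finally show ?thesis using a by (simp add: R_def)
  qed
  show ?thesis
  proof (rule that)
    show "a > 0" by fact
    show "mono R"
    proof (rule monoI)
      fix m n :: nat assume "m \<le> n"
      then have "\<phi> (real (m + 1)) \<le> \<phi> (real (n + 1))" by (intro \<phi>_mono) auto
      then show "R m \<le> R n" using a by (simp add: R_def mult_left_mono)
    qed
    show "R n \<ge> 1" for n by (rule R_ge_1)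
    show "R n \<ge> real n" for n
    proof -
      let ?N = "real (n + 1)"
      have "ln ?N \<le> ?N powr s / s" using s by (intro ln_powr_bound) auto
      also have "\<dots> = (2 / s) * (?N powr s / 2)" by simp
      also have "\<dots> \<le> a * \<phi> ?N"
        using a s by (intro mult_mono \<phi>_low) auto
      finally have "exp (ln ?N) \<le> R n" unfolding R_def by (simp only: exp_le_cancel_iff)
      then show ?thesis by simp
    qed
    show "ln (R n) \<le> a * real (n + 1) powr s" for n
      using \<phi>_up[of "real (n + 1)"] a by (simp add: R_def)
    show "K * real n powr D * (R m * R (n - 1 - m)) powr d \<le> R n powr (d * \<beta>)" if "m < n" for m n
    proof -
      define p q N where "p = real (m + 1)" and "q = real (n - 1 - m + 1)" and "N = real (n + 1)"
      have pq: "p \<ge> 1" "q \<ge> 1" and N: "N = p + q" "N \<ge> 1" using that by (auto simp: p_def q_def N_def)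
      have Nt: "N powr t \<ge> 1" using N t by (intro ge_one_powr_ge_zero) auto
      have "K \<le> exp (\<bar>ln K\<bar> * N powr t)"
      proof -
        have "K = exp (ln K)" using assms by simp
        also have "\<dots> \<le> exp (\<bar>ln K\<bar> * N powr t)"
          using mult_left_mono[OF Nt, of "\<bar>ln K\<bar>"] by auto
        finally show ?thesis .
      qed
      moreover have "real n powr D \<le> exp (D / t * N powr t)"
      proof -
        have "real n powr D \<le> N powr D" using assms by (intro powr_mono2) (auto simp: N_def)
        also have "\<dots> = exp (D * ln N)" using N by (simp add: powr_def)
        also have "\<dots> \<le> exp (D * (N powr t / t))"
          using N t assms by (intro iffD2[OF exp_le_cancel_iff] mult_left_mono ln_powr_bound) auto
        finally show ?thesis by simp
      qed
      moreover have "(R m * R (n - 1 - m)) powr d = exp (d * a * (\<phi> p + \<phi> q))"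
        by (simp add: R_def p_def q_def flip: exp_add) (simp add: powr_def algebra_simps)
      ultimately have "K * real n powr D * (R m * R (n - 1 - m)) powr d
          \<le> exp (\<bar>ln K\<bar> * N powr t) * exp (D / t * N powr t) * exp (d * a * (\<phi> p + \<phi> q))"
        using assms by (intro mult_mono) auto
      also have "\<dots> = exp ((\<bar>ln K\<bar> + D / t) * N powr t + d * a * (\<phi> p + \<phi> q))"
        by (simp add: algebra_simps flip: exp_add)
      also have "\<dots> \<le> exp (d * a * (\<beta> * \<phi> N))"
      proof (rule iffD2[OF exp_le_cancel_iff])
        have "(\<bar>ln K\<bar> + D / t) * N powr t \<le> (a * c) * N powr t"
          using a by (intro mult_right_mono) auto
        also have "\<dots> = 1 * (a * c * N powr t)" by simp
        also have "\<dots> \<le> d * (a * c * N powr t)" using assms a c by (intro mult_right_mono) auto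
        finally have "(\<bar>ln K\<bar> + D / t) * N powr t + d * a * (\<phi> p + \<phi> q) \<le> d * a * (\<phi> p + \<phi> q + c * N powr t)"
          by (simp add: algebra_simps)
        also have "\<dots> \<le> d * a * (\<beta> * \<phi> N)"
          using \<phi>_gap[OF pq] a assms by (intro mult_left_mono) (auto simp: N)
        finally show "(\<bar>ln K\<bar> + D / t) * N powr t + d * a * (\<phi> p + \<phi> q) \<le> d * a * (\<beta> * \<phi> N)" .
      qed
      also have "\<dots> = R n powr (d * \<beta>)" by (simp add: R_def N_def powr_def algebra_simps)
      finally show ?thesis .
    qed
  qed
qed

section \<open>Skeletons of self-avoiding walks\<close>

text \<open>
  The mark of an edge says which exponent it is given in the probability bound: \<open>\<beta>\<close> for \<open>True\<close>,
  and \<open>\<eta>\<close> for \<open>False\<close>.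
\<close>

type_synonym 'v marked_edges = "(bool \<times> 'v \<times> 'v) list"

text \<open>
  \<open>skeleton R n x y s\<close> describes what may be recorded about a walk of \<open>n\<close> edges from \<open>x\<close> to \<open>y\<close>.
  Between far endpoints, an edge \<open>(u, v)\<close> of length at least \<open>|x - y| / n\<close> is recorded, together
  with the two arms that lead to it. An arm ends with the edge of the walk next to \<open>(u, v)\<close>, and this
  edge gets the mark \<open>False\<close>, or is left out if it may belong to the grid. The second arm is read from
  \<open>y\<close> backwards, so that both arms end at the long edge and one notion of arm suffices.
\<close>

inductive skeleton :: "(nat \<Rightarrow> real) \<Rightarrow> nat \<Rightarrow> int ^ 'd \<Rightarrow> int ^ 'd \<Rightarrow> (int ^ 'd) marked_edges \<Rightarrow> bool"
  and arm :: "(nat \<Rightarrow> real) \<Rightarrow> nat \<Rightarrow> int ^ 'd \<Rightarrow> int ^ 'd \<Rightarrow> (int ^ 'd) marked_edges \<Rightarrow> bool"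
  for R :: "nat \<Rightarrow> real"
where
  short: "eucl x y \<le> R n \<Longrightarrow> skeleton R n x y []"
| split: "R n < eucl x y \<Longrightarrow> n = Suc (m + m') \<Longrightarrow> eucl x y \<le> real n * eucl u v \<Longrightarrow>
    arm R m x u s \<Longrightarrow> arm R m' y v s' \<Longrightarrow> skeleton R n x y (s @ (True, u, v) # s')"
| arm_0: "arm R 0 x x []"
| arm_grid: "skeleton R m x u' s \<Longrightarrow> eucl u' u = 1 \<Longrightarrow> arm R (Suc m) x u s"
| arm_long: "skeleton R m x u' s \<Longrightarrow> u' \<noteq> u \<Longrightarrow> arm R (Suc m) x u (s @ [(False, u', u)])"

text \<open>
  The exponent with which the weight of \<open>z\<close> enters the bound for the probability that all edges of
  \<open>s\<close> are present.
\<close>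

definition load :: "real \<Rightarrow> real \<Rightarrow> 'v marked_edges \<Rightarrow> 'v \<Rightarrow> real" where
  "load \<beta> \<eta> s z = (\<Sum>(h, u, v)\<leftarrow>s. if z = u \<or> z = v then (if h then \<beta> else \<eta>) else 0)"

text \<open>
  Distinctness refers to unordered pairs, because the edges of second arms are traversed against the
  direction of the walk.
\<close>

definition admissible :: "real \<Rightarrow> real \<Rightarrow> 'v marked_edges \<Rightarrow> bool" where
  "admissible \<beta> \<eta> s \<longleftrightarrow> (\<forall>(h, u, v)\<in>set s. u \<noteq> v) \<and> distinct (map (\<lambda>(h, u, v). {u, v}) s) \<and>
    (\<forall>z. load \<beta> \<eta> s z \<le> \<beta> + \<eta>)"

definition edges_within :: "'v rel \<Rightarrow> 'v set \<Rightarrow> 'v marked_edges \<Rightarrow> bool" where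
  "edges_within E V s \<longleftrightarrow> (\<forall>(h, u, v)\<in>set s. u \<in> V \<and> v \<in> V \<and> (u, v) \<in> E)"

lemma load_Nil [simp]: "load \<beta> \<eta> [] z = 0"
  by (simp add: load_def)

lemma load_Cons [simp]:
  "load \<beta> \<eta> ((h, u, v) # s) z = (if z = u \<or> z = v then (if h then \<beta> else \<eta>) else 0) + load \<beta> \<eta> s z"
  by (simp add: load_def)

lemma load_append [simp]: "load \<beta> \<eta> (s @ s') z = load \<beta> \<eta> s z + load \<beta> \<eta> s' z"
  by (simp add: load_def)

lemma load_outside: "edges_within E V s \<Longrightarrow> z \<notin> V \<Longrightarrow> load \<beta> \<eta> s z = 0"
  by (induction s) (auto simp: edges_within_def)

lemma edges_within_Cons [simp]:
  "edges_within E V ((h, u, v) # s) \<longleftrightarrow> u \<in> V \<and> v \<in> V \<and> (u, v) \<in> E \<and> edges_within E V s"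
  by (simp add: edges_within_def)

lemma edges_within_append [simp]:
  "edges_within E V (s @ s') \<longleftrightarrow> edges_within E V s \<and> edges_within E V s'"
  by (simp add: edges_within_def ball_Un)

lemma edges_within_mono: "edges_within E V s \<Longrightarrow> V \<subseteq> V' \<Longrightarrow> edges_within E V' s"
  by (fastforce simp: edges_within_def)

lemma edges_within_pair:
  assumes "edges_within E V s" "P \<in> set (map (\<lambda>(h, u, v). {u, v}) s)"
  shows "P \<subseteq> V" "P \<noteq> {}"
  using assms by (fastforce simp: edges_within_def)+

lemma skeleton_refl: "skeleton R n x x s \<Longrightarrow> 0 \<le> R n \<Longrightarrow> s = []"
  by (erule skeleton.cases) auto

lemma ex_long_step:
  assumes "0 < n"
  shows "\<exists>i<n. eucl (f 0) (f n) \<le> real n * eucl (f i) (f (Suc i))"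
proof -
  let ?e = "\<lambda>i. eucl (f i) (f (Suc i))"
  have "Max (?e ` {..<n}) \<in> ?e ` {..<n}" using assms by (intro Max_in) auto
  then obtain i where i: "i < n" "Max (?e ` {..<n}) = ?e i" by auto
  then have le: "?e j \<le> ?e i" if "j < n" for j
    using Max_ge[of "?e ` {..<n}" "?e j"] that by auto
  have "eucl (f 0) (f m) \<le> real m * ?e i" if "m \<le> n" for m
    using that
  proof (induction m)
    case (Suc m)
    have "eucl (f 0) (f (Suc m)) \<le> eucl (f 0) (f m) + ?e m" by (rule eucl_triangle)
    then show ?case using Suc le[of m] by (simp add: algebra_simps)
  qed simp
  then show ?thesis using i by auto
qed

text \<open>
  The purpose of the marks: along a self-avoiding walk every vertex meets at most two recorded edges,
  and they are never both marked \<open>True\<close>, since an edge adjacent to a recorded long edge is either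
  omitted or marked \<open>False\<close>. The bounds on the load at the endpoints of the walk are what the
  induction needs when another edge is attached there.

  The radii are at least \<open>n\<close>, so a recorded long edge has length more than \<open>1\<close> and therefore does not
  belong to the grid.
\<close>

lemma skeleton_of_path:
  fixes f :: "nat \<Rightarrow> int ^ 'd"
  assumes "sym L" and \<eta>: "0 < \<eta>" "\<eta> \<le> \<beta>" and R: "\<And>n. real n \<le> R n"
  shows "inj_on f {..n} \<Longrightarrow> (\<And>i. i < n \<Longrightarrow> (f i, f (Suc i)) \<in> grid_edges \<union> L) \<Longrightarrow>
    \<exists>s. skeleton R n (f 0) (f n) s \<and> admissible \<beta> \<eta> s \<and> edges_within L (f ` {..n}) s \<and>
      load \<beta> \<eta> s (f 0) \<le> \<beta> \<and> load \<beta> \<eta> s (f n) \<le> \<beta>"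
proof (induction n arbitrary: f rule: less_induct)
  case (less n)
  have R0: "0 \<le> R k" for k using R[of k] by (meson of_nat_0_le_iff order_trans)
  have arm: "\<exists>s. arm R m (g 0) (g m) s \<and> admissible \<beta> \<eta> s \<and> edges_within L (g ` {..m}) s \<and>
      load \<beta> \<eta> s (g 0) \<le> \<beta> \<and> load \<beta> \<eta> s (g m) \<le> \<eta> \<and> (m = 0 \<longrightarrow> s = [])"
    if m: "m < n" and inj: "inj_on g {..m}" and step: "\<And>i. i < m \<Longrightarrow> (g i, g (Suc i)) \<in> grid_edges \<union> L" for m g
  proof (cases m)
    case 0
    show ?thesis
      by (rule exI[of _ "[]"]) (use 0 \<eta> in \<open>auto simp: arm_0 admissible_def edges_within_def\<close>)
  next
    case (Suc k)
    have injk: "inj_on g {..k}" by (rule inj_on_subset[OF inj]) (use Suc in auto)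
    obtain s where s: "skeleton R k (g 0) (g k) s" "admissible \<beta> \<eta> s" "edges_within L (g ` {..k}) s"
      "load \<beta> \<eta> s (g 0) \<le> \<beta>" "load \<beta> \<eta> s (g k) \<le> \<beta>"
      using less.IH[of k g] injk step m Suc by auto
    have new: "g (Suc k) \<notin> g ` {..k}"
    proof
      assume "g (Suc k) \<in> g ` {..k}"
      then obtain j where "j \<le> k" "g (Suc k) = g j" by auto
      then show False using inj_onD[OF inj, of "Suc k" j] Suc by auto
    qed
    have sub: "g ` {..k} \<subseteq> g ` {..m}" using Suc by auto
    have out: "load \<beta> \<eta> s (g (Suc k)) = 0" using s(3) new by (rule load_outside)
    show ?thesis
    proof (cases "(g k, g (Suc k)) \<in> grid_edges")
      case True
      then have "arm R m (g 0) (g m) s" unfolding Suc using s(1) by (intro arm_grid[of R k]) (auto simp: grid_edges_def)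
      then show ?thesis
        using s edges_within_mono[OF s(3) sub] out \<eta> Suc by auto
    next
      case False
      then have L: "(g k, g (Suc k)) \<in> L" using step[of k] Suc by auto
      have ne: "g k \<noteq> g (Suc k)" using inj_onD[OF inj, of k "Suc k"] Suc by auto
      let ?s = "s @ [(False, g k, g (Suc k))]"
      have "arm R m (g 0) (g m) ?s" unfolding Suc by (rule arm_long[OF s(1) ne])
      moreover have "edges_within L (g ` {..m}) ?s"
        using edges_within_mono[OF s(3) sub] L Suc by (auto simp: edges_within_def)
      moreover have "admissible \<beta> \<eta> ?s"
      proof -
        have "{g k, g (Suc k)} \<notin> set (map (\<lambda>(h, u, v). {u, v}) s)"
          using edges_within_pair(1)[OF s(3)] new by blast
        moreover have "load \<beta> \<eta> ?s z \<le> \<beta> + \<eta>" for z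
          using s(2,5) out \<eta> by (auto simp: admissible_def)
        ultimately show ?thesis using s(2) ne by (simp add: admissible_def)
      qed
      \<comment> \<open>If the walk up to \<open>g k\<close> is trivial, then \<open>g 0\<close> is an end of the new edge, but nothing else is
        recorded.\<close>
      moreover have "load \<beta> \<eta> ?s (g 0) \<le> \<beta>"
      proof (cases "k = 0")
        case True
        then have "s = []" using s(1) R0 by (auto intro: skeleton_refl)
        then show ?thesis using \<eta> by simp
      next
        case False
        then have "g 0 \<noteq> g k" "g 0 \<noteq> g (Suc k)" using inj_onD[OF inj, of 0 k] inj_onD[OF inj, of 0 "Suc k"] False Suc by auto
        then show ?thesis using s(4) by simp
      qed
      moreover have "load \<beta> \<eta> ?s (g m) \<le> \<eta>" using out Suc by simp
      moreover have "m = 0 \<longrightarrow> ?s = []" using Suc by simp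
      ultimately show ?thesis by blast
    qed
  qed
  show ?case
  proof (cases "eucl (f 0) (f n) \<le> R n")
    case True
    then show ?thesis
      by (intro exI[of _ "[]"]) (use \<eta> in \<open>simp add: short admissible_def edges_within_def\<close>)
  next
    case False
    then have far: "R n < eucl (f 0) (f n)" by simp
    have "n > 0"
    proof (rule ccontr)
      assume "\<not> 0 < n" then show False using far R0[of n] by simp
    qed
    then obtain i where i: "i < n" "eucl (f 0) (f n) \<le> real n * eucl (f i) (f (Suc i))"
      using ex_long_step[of n f] by blast
    define m' where "m' = n - Suc i"
    define g where "g j = f (n - j)" for j
    have n: "n = Suc (i + m')" using i by (simp add: m'_def)
    obtain s where s: "arm R i (f 0) (f i) s" "admissible \<beta> \<eta> s" "edges_within L (f ` {..i}) s"
      "load \<beta> \<eta> s (f 0) \<le> \<beta>" "load \<beta> \<eta> s (f i) \<le> \<eta>" "i = 0 \<longrightarrow> s = []"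
    proof -
      have "inj_on f {..i}" by (rule inj_on_subset[OF less.prems(1)]) (use i in auto)
      then show ?thesis using arm[of i f] i less.prems(2) that by auto
    qed
    obtain s' where s': "arm R m' (g 0) (g m') s'" "admissible \<beta> \<eta> s'" "edges_within L (g ` {..m'}) s'"
      "load \<beta> \<eta> s' (g 0) \<le> \<beta>" "load \<beta> \<eta> s' (g m') \<le> \<eta>" "m' = 0 \<longrightarrow> s' = []"
    proof -
      have "inj_on g {..m'}"
      proof (rule inj_onI)
        fix a b assume ab: "a \<in> {..m'}" "b \<in> {..m'}" "g a = g b"
        then have "n - a = n - b" using less.prems(1) by (auto simp: g_def inj_on_def)
        then show "a = b" using ab n by auto
      qed
      moreover have "(g j, g (Suc j)) \<in> grid_edges \<union> L" if "j < m'" for j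
      proof -
        have "(f (n - Suc j), f (Suc (n - Suc j))) \<in> grid_edges \<union> L" using that n by (intro less.prems(2)) auto
        moreover have "Suc (n - Suc j) = n - j" using that n by simp
        ultimately have "(g (Suc j), g j) \<in> grid_edges \<union> L" by (simp add: g_def)
        then show ?thesis using \<open>sym L\<close> eucl_commute[of "g j"] by (auto simp: grid_edges_def sym_def)
      qed
      ultimately show ?thesis using arm[of m' g] n that by auto
    qed
    have g: "g 0 = f n" "g m' = f (Suc i)" using n by (auto simp: g_def)
    let ?V = "f ` {..i}" and ?V' = "g ` {..m'}"
    let ?s = "s @ (True, f i, f (Suc i)) # s'"
    have disj: "?V \<inter> ?V' = {}" 
    proof -
      have "f a \<noteq> f (n - b)" if "a \<le> i" "b \<le> m'" for a b
      proof -
        have "a \<noteq> n - b" "a \<le> n" using that n by auto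
        then show ?thesis using inj_onD[OF less.prems(1), of a "n - b"] by auto
      qed
      then show ?thesis by (auto simp: g_def)
    qed
    have sub: "?V \<subseteq> f ` {..n}" "?V' \<subseteq> f ` {..n}" using n by (auto simp: g_def)
    have in_V: "f 0 \<in> ?V" "f i \<in> ?V" and in_V': "f n \<in> ?V'" "f (Suc i) \<in> ?V'"
      using g by (auto intro!: image_eqI[of "f n" g 0] image_eqI[of "f (Suc i)" g m'])
    have out: "load \<beta> \<eta> s z = 0" if "z \<in> ?V'" for z using load_outside[OF s(3)] disj that by blast
    have out': "load \<beta> \<eta> s' z = 0" if "z \<in> ?V" for z using load_outside[OF s'(3)] disj that by blast
    have neq: "a \<noteq> b" if "a \<in> ?V" "b \<in> ?V'" for a b using that disj by blast
    have ne: "f i \<noteq> f (Suc i)" by (rule neq[OF in_V(2) in_V'(2)])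
    have "real n * 1 < real n * eucl (f i) (f (Suc i))" using far R[of n] i(2) by linarith
    then have "1 < eucl (f i) (f (Suc i))" using \<open>n > 0\<close> by (simp only: mult_less_cancel_left_pos of_nat_0_less_iff)
    then have L: "(f i, f (Suc i)) \<in> L" using less.prems(2)[OF i(1)] by (auto simp: grid_edges_def)
    have "skeleton R n (f 0) (f n) ?s"
      using skeleton_arm.split[OF far n i(2) s(1)] s'(1) g by simp
    moreover have "edges_within L (f ` {..n}) ?s"
      using edges_within_mono[OF s(3) sub(1)] edges_within_mono[OF s'(3) sub(2)] L
        subsetD[OF sub(1) in_V(2)] subsetD[OF sub(2) in_V'(2)] by simp
    moreover have "admissible \<beta> \<eta> ?s"
    proof -
      let ?P = "\<lambda>s. set (map (\<lambda>(h, u, v). {u, v}) s)"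
      have P: "p \<subseteq> ?V" "p \<noteq> {}" if "p \<in> ?P s" for p by (rule edges_within_pair[OF s(3) that])+
      have P': "p \<subseteq> ?V'" "p \<noteq> {}" if "p \<in> ?P s'" for p by (rule edges_within_pair[OF s'(3) that])+
      have "{f i, f (Suc i)} \<notin> ?P s" using P(1) in_V' disj by blast
      moreover have "{f i, f (Suc i)} \<notin> ?P s'" using P'(1) in_V disj by blast
      moreover have "?P s \<inter> ?P s' = {}"
      proof (rule equals0I, erule IntE)
        fix p assume p: "p \<in> ?P s" "p \<in> ?P s'"
        have "p \<subseteq> ?V \<inter> ?V'" using P(1)[OF p(1)] P'(1)[OF p(2)] by (rule Int_greatest)
        then show False using P(2)[OF p(1)] disj by (simp only: subset_empty)
      qed
      ultimately have "distinct (map (\<lambda>(h, u, v). {u, v}) ?s)" using s(2) s'(2) by (simp add: admissible_def)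
      moreover have "load \<beta> \<eta> ?s z \<le> \<beta> + \<eta>" for z
      proof (cases "z \<in> ?V")
        case True
        then have "z \<noteq> f (Suc i)" by (rule neq[OF _ in_V'(2)])
        then show ?thesis using out'[OF True] s(2,5) by (auto simp: admissible_def)
      next
        case False
        then have "z \<noteq> f i" "load \<beta> \<eta> s z = 0" using in_V load_outside[OF s(3)] by auto
        then show ?thesis using s'(2,5) g by (auto simp: admissible_def)
      qed
      ultimately show ?thesis using s(2) s'(2) ne by (auto simp: admissible_def)
    qed
    moreover have "load \<beta> \<eta> ?s (f 0) \<le> \<beta>"
    proof -
      have "f 0 \<noteq> f (Suc i)" by (rule neq[OF in_V(1) in_V'(2)])
      moreover have "f 0 \<noteq> f i" if "i \<noteq> 0"
        using inj_onD[OF less.prems(1), of 0 i] that i by auto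
      ultimately show ?thesis using out'[OF in_V(1)] s(4,6) \<eta> by (cases "i = 0") auto
    qed
    moreover have "load \<beta> \<eta> ?s (f n) \<le> \<beta>"
    proof -
      have "f n \<noteq> f i" by (rule neq[OF in_V(2) in_V'(1), symmetric])
      moreover have "f n \<noteq> f (Suc i)" if "m' \<noteq> 0"
        using inj_onD[OF less.prems(1), of n "Suc i"] that n by auto
      ultimately show ?thesis using out[OF in_V'(1)] s'(4,6) g \<eta> by (cases "m' = 0") auto
    qed
    ultimately show ?thesis by blast
  qed
qed

lemma shortest_walk_inj:
  assumes f: "f 0 = x" "f n = y" "\<And>i. i < n \<Longrightarrow> (f i, f (Suc i)) \<in> E"
    and min: "\<And>m. m < n \<Longrightarrow> (x, y) \<notin> E ^^ m"
  shows "inj_on f {..n}"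
proof (rule inj_onI)
  have seg: "(f a, f b) \<in> E ^^ (b - a)" if "a \<le> b" "b \<le> n" for a b
    using f(3) that by (auto simp: relpow_fun_conv intro!: exI[of _ "\<lambda>i. f (a + i)"])
  have *: False if "a < b" "b \<le> n" "f a = f b" for a b
  proof -
    have "(x, f a) \<in> E ^^ a" "(f a, y) \<in> E ^^ (n - b)" using seg[of 0 a] seg[of b n] that f by auto
    then have "(x, y) \<in> E ^^ (a + (n - b))" by (auto simp: relpow_add)
    moreover have "a + (n - b) < n" using that by arith
    ultimately show False using min by blast
  qed
  fix a b assume "a \<in> {..n}" "b \<in> {..n}" "f a = f b"
  then show "a = b" using *[of a b] *[of b a] by (metis atMost_iff linorder_neqE_nat)
qed

lemma le_graph_dist_iff:
  "ereal b \<le> ereal_of_enat (graph_dist E x y) \<longleftrightarrow> (\<forall>n. (x, y) \<in> E ^^ n \<longrightarrow> b \<le> real n)"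
proof (intro iffI allI impI)
  fix n assume b: "ereal b \<le> ereal_of_enat (graph_dist E x y)" and n: "(x, y) \<in> E ^^ n"
  have "graph_dist E x y \<le> enat n" unfolding graph_dist_def using n by (intro INF_lower) simp
  then have "ereal_of_enat (graph_dist E x y) \<le> ereal_of_enat (enat n)" by (simp only: ereal_of_enat_le_iff)
  with b have "ereal b \<le> ereal_of_enat (enat n)" by (rule order_trans)
  then show "b \<le> real n" by simp
next
  assume all: "\<forall>n. (x, y) \<in> E ^^ n \<longrightarrow> b \<le> real n"
  let ?D = "enat ` {n. (x, y) \<in> E ^^ n}"
  show "ereal b \<le> ereal_of_enat (graph_dist E x y)"
  proof (cases "?D = {}")
    case True
    have "graph_dist E x y = \<infinity>" unfolding graph_dist_def True by (simp add: top_enat_def)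
    then show ?thesis by simp
  next
    case False
    then have "graph_dist E x y \<in> ?D"
      unfolding graph_dist_def Inf_enat_def by (simp only: if_False) (metis LeastI_ex ex_in_conv)
    then show ?thesis using all by auto
  qed
qed

text \<open>
  A walk of minimal length is self-avoiding, so every pair at small graph distance comes with a
  skeleton all of whose edges are present.
\<close>

lemma skeleton_of_close_pair:
  fixes x y :: "int ^ 'd"
  assumes "sym L" and "0 < \<eta>" "\<eta> \<le> \<beta>" and "\<And>n. real n \<le> R n"
    and lt: "\<not> ereal b \<le> ereal_of_enat (graph_dist (grid_edges \<union> L) x y)"
  shows "\<exists>n s. real n < b \<and> skeleton R n x y s \<and> admissible \<beta> \<eta> s \<and> (\<forall>(h, u, v)\<in>set s. (u, v) \<in> L)"
proof -
  let ?E = "grid_edges \<union> L"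
  obtain n0 where n0: "(x, y) \<in> ?E ^^ n0" "real n0 < b" using lt by (auto simp: le_graph_dist_iff not_le)
  define n where "n = (LEAST n. (x, y) \<in> ?E ^^ n)"
  have n: "(x, y) \<in> ?E ^^ n" unfolding n_def using n0(1) by (rule LeastI)
  have "n \<le> n0" unfolding n_def using n0(1) by (rule Least_le)
  have min: "(x, y) \<notin> ?E ^^ m" if "m < n" for m using that not_less_Least unfolding n_def by blast
  obtain f where f: "f 0 = x" "f n = y" "\<And>i. i < n \<Longrightarrow> (f i, f (Suc i)) \<in> ?E"
    using n by (auto simp: relpow_fun_conv)
  obtain s where "skeleton R n (f 0) (f n) s" "admissible \<beta> \<eta> s" "edges_within L (f ` {..n}) s"
    using skeleton_of_path[OF assms(1-4) shortest_walk_inj[OF f min] f(3)] by blast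
  moreover have "real n < b" using \<open>n \<le> n0\<close> n0(2) by linarith
  ultimately show ?thesis using f by (intro exI[of _ n] exI[of _ s]) (auto simp: edges_within_def)
qed

section \<open>The probability of a skeleton\<close>

definition marked_weight :: "real \<Rightarrow> real \<Rightarrow> real \<Rightarrow> (int ^ 'd) marked_edges \<Rightarrow> ennreal" where
  "marked_weight A \<beta> \<eta> s =
    (\<Prod>(h, u, v)\<leftarrow>s. ennreal (A * eucl u v powr - (real CARD('d) * (if h then \<beta> else \<eta>))))"

definition mass :: "real \<Rightarrow> real \<Rightarrow> real \<Rightarrow> (int ^ 'd) marked_edges set \<Rightarrow> ennreal" where
  "mass A \<beta> \<eta> T = (\<integral>\<^sup>+s. marked_weight A \<beta> \<eta> s * indicator T s \<partial>count_space UNIV)"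

lemma conn_prob_nonneg: "0 < l \<Longrightarrow> 0 \<le> conn_prob \<alpha> l w u v"
  by (simp add: conn_prob_def)

text \<open>
  The minimum with \<open>1\<close> allows to lower the exponent \<open>\<alpha>\<close> to any \<open>\<theta>\<close>, trading decay in the distance
  for a weaker moment condition on the weights.
\<close>

lemma conn_prob_le_powr:
  fixes u v :: "int ^ 'd"
  assumes "u \<noteq> v" "1 \<le> w u" "1 \<le> w v" "0 < l" "0 \<le> \<theta>" "\<theta> \<le> \<alpha>"
  shows "conn_prob \<alpha> l w u v \<le> max 1 l * eucl u v powr - (real CARD('d) * \<theta>) * (w u * w v) powr \<theta>"
proof -
  define X where "X = (w u * w v) / eucl u v ^ CARD('d)"
  have r: "eucl u v \<ge> 1" using assms by (intro eucl_ge_1)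
  have X: "X > 0" using assms r by (simp add: X_def)
  have "conn_prob \<alpha> l w u v \<le> max 1 l * X powr \<theta>"
  proof (cases "X \<ge> 1")
    case True
    then have "1 * 1 \<le> max 1 l * X powr \<theta>"
      using assms by (intro mult_mono ge_one_powr_ge_zero) auto
    then show ?thesis by (simp add: conn_prob_def min_le_iff_disj)
  next
    case False
    then have "l * X powr \<alpha> \<le> max 1 l * X powr \<theta>"
      using assms X by (intro mult_mono powr_mono') auto
    then show ?thesis unfolding conn_prob_def X_def by linarith
  qed
  also have "X powr \<theta> = eucl u v powr - (real CARD('d) * \<theta>) * (w u * w v) powr \<theta>"
    using assms r by (simp add: X_def powr_divide powr_minus powr_powr field_simps flip: powr_realpow)
  finally show ?thesis by (simp add: mult.assoc)
qed

text \<open>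
  Collecting the weight factors vertex by vertex turns a product over edges into a product over
  vertices, to which independence of the weights applies.
\<close>

lemma prod_conn_prob_le:
  fixes s :: "(int ^ 'd) marked_edges"
  assumes "finite V" "\<And>z. z \<in> V \<Longrightarrow> 1 \<le> w z" "0 < l" "0 \<le> \<beta>" "\<beta> \<le> \<alpha>" "0 \<le> \<eta>" "\<eta> \<le> \<alpha>"
    and "\<And>h u v. (h, u, v) \<in> set s \<Longrightarrow> u \<noteq> v \<and> u \<in> V \<and> v \<in> V"
  shows "(\<Prod>(h, u, v)\<leftarrow>s. conn_prob \<alpha> l w u v) \<le>
    (\<Prod>(h, u, v)\<leftarrow>s. max 1 l * eucl u v powr - (real CARD('d) * (if h then \<beta> else \<eta>))) *
    (\<Prod>z\<in>V. w z powr load \<beta> \<eta> s z)"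
  using assms(8)
proof (induction s)
  case Nil
  have "(\<Prod>z\<in>V. w z powr 0) = (\<Prod>z\<in>V. 1)"
    by (intro prod.cong) (use assms(2) in force)+
  then show ?case by simp
next
  case (Cons e s)
  obtain h u v where e: "e = (h, u, v)" by (cases e)
  define \<theta> where "\<theta> = (if h then \<beta> else \<eta>)"
  have uv: "u \<noteq> v" "u \<in> V" "v \<in> V" using Cons.prems[of h u v] e by auto
  have "(\<Prod>z\<in>V. w z powr load \<beta> \<eta> (e # s) z) =
      (\<Prod>z\<in>V. w z powr (if z = u \<or> z = v then \<theta> else 0)) * (\<Prod>z\<in>V. w z powr load \<beta> \<eta> s z)"
  proof -
    have "load \<beta> \<eta> (e # s) z = (if z = u \<or> z = v then \<theta> else 0) + load \<beta> \<eta> s z" for z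
      by (simp add: e \<theta>_def)
    then show ?thesis by (simp only: powr_add prod.distrib)
  qed
  also have "(\<Prod>z\<in>V. w z powr (if z = u \<or> z = v then \<theta> else 0)) = (\<Prod>z\<in>{u, v}. w z powr \<theta>)"
  proof (rule prod.mono_neutral_cong_right)
    show "\<forall>z\<in>V - {u, v}. w z powr (if z = u \<or> z = v then \<theta> else 0) = 1"
    proof
      fix z assume z: "z \<in> V - {u, v}"
      then have "w z \<noteq> 0" using assms(2)[of z] by auto
      then show "w z powr (if z = u \<or> z = v then \<theta> else 0) = 1" using z by auto
    qed
  qed (use assms(1) uv in auto)
  also have "\<dots> = (w u * w v) powr \<theta>"
    using uv assms(2)[of u] assms(2)[of v] by (simp add: powr_mult)
  finally have eq: "(\<Prod>z\<in>V. w z powr load \<beta> \<eta> (e # s) z) =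
    (w u * w v) powr \<theta> * (\<Prod>z\<in>V. w z powr load \<beta> \<eta> s z)" .
  have "conn_prob \<alpha> l w u v * (\<Prod>(h, u, v)\<leftarrow>s. conn_prob \<alpha> l w u v) \<le>
    (max 1 l * eucl u v powr - (real CARD('d) * \<theta>) * (w u * w v) powr \<theta>) *
    ((\<Prod>(h, u, v)\<leftarrow>s. max 1 l * eucl u v powr - (real CARD('d) * (if h then \<beta> else \<eta>))) *
    (\<Prod>z\<in>V. w z powr load \<beta> \<eta> s z))"
  proof (rule mult_mono)
    show "conn_prob \<alpha> l w u v \<le> max 1 l * eucl u v powr - (real CARD('d) * \<theta>) * (w u * w v) powr \<theta>"
      using uv assms by (intro conn_prob_le_powr) (auto simp: \<theta>_def)
    show "0 \<le> (\<Prod>(h, u, v)\<leftarrow>s. conn_prob \<alpha> l w u v)"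
      using \<open>0 < l\<close> by (intro prod_list_nonneg) (auto simp: conn_prob_nonneg)
  qed (use Cons in auto)
  then show ?case unfolding eq by (simp add: e \<theta>_def mult_ac)
qed

context scale_free_percolation
begin

lemma W_measurable [measurable]: "W x \<in> borel_measurable M"
  using indep_weights by (auto simp: indep_vars_def2)

lemma AE_W_ge_1: "AE \<omega> in M. 1 \<le> W x \<omega>"
proof -
  have "prob {\<omega> \<in> space M. 1 \<le> W x \<omega>} = 1" using weight_tail[of 1 x] by simp
  from AE_prob_1[OF this] show ?thesis by auto
qed

text \<open>
  The tail exponent of the weights is \<open>\<tau> - 1\<close>, hence all moments of smaller order are finite. The sum
  over dyadic values of the weight shows this with a bound that does not depend on the vertex.
\<close>

lemma weight_moment_bounded:
  assumes "0 \<le> \<sigma>" "\<sigma> < \<tau> - 1"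
  obtains m where "m \<ge> 1" "\<And>x. (\<integral>\<^sup>+\<omega>. ennreal (W x \<omega> powr \<sigma>) \<partial>M) \<le> ennreal m"
proof -
  define q where "q = 2 powr (\<sigma> + 1 - \<tau>)"
  have q: "0 < q" "q < 1" using assms by (auto simp: q_def intro: powr_less_one)
  have "(\<integral>\<^sup>+\<omega>. ennreal (W x \<omega> powr \<sigma>) \<partial>M) \<le> ennreal (max 1 (2 powr \<sigma> / (1 - q)))" for x
  proof -
    let ?f = "\<lambda>n \<omega>. ennreal (2 powr (\<sigma> * real (Suc n))) * indicator {\<omega> \<in> space M. 2 ^ n \<le> W x \<omega>} \<omega>"
    have "(\<integral>\<^sup>+\<omega>. ennreal (W x \<omega> powr \<sigma>) \<partial>M) \<le> (\<integral>\<^sup>+\<omega>. (\<Sum>n. ?f n \<omega>) \<partial>M)"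
    proof (rule nn_integral_mono_AE, use AE_W_ge_1[of x] AE_space in eventually_elim)
      fix \<omega> assume \<omega>: "1 \<le> W x \<omega>" "\<omega> \<in> space M"
      have ex: "\<exists>n. W x \<omega> < 2 ^ Suc n"
      proof -
        obtain n where "W x \<omega> < 2 ^ n" using real_arch_pow[of 2] by auto
        also have "(2::real) ^ n \<le> 2 ^ Suc n" by simp
        finally show ?thesis by blast
      qed
      define n where "n = (LEAST n. W x \<omega> < 2 ^ Suc n)"
      have up: "W x \<omega> < 2 ^ Suc n" unfolding n_def using ex by (rule LeastI_ex)
      have low: "2 ^ n \<le> W x \<omega>"
      proof (cases n)
        case (Suc k)
        then show ?thesis using not_less_Least[of k "\<lambda>n. W x \<omega> < 2 ^ Suc n"] unfolding n_def by simp
      qed (use \<omega> in simp)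
      have "W x \<omega> powr \<sigma> \<le> (2 ^ Suc n) powr \<sigma>" using up \<omega> assms by (intro powr_mono2) auto
      also have "\<dots> = 2 powr (\<sigma> * real (Suc n))"
        by (simp only: powr_realpow[symmetric] powr_powr mult.commute zero_less_numeral)
      finally have "ennreal (W x \<omega> powr \<sigma>) \<le> ?f n \<omega>" using low \<omega> by (simp add: ennreal_leI)
      also have "\<dots> = (\<Sum>n\<in>{n}. ?f n \<omega>)" by (subst sum.insert) auto
      also have "\<dots> \<le> (\<Sum>n. ?f n \<omega>)" by (intro sum_le_suminf summableI) auto
      finally show "ennreal (W x \<omega> powr \<sigma>) \<le> (\<Sum>n. ?f n \<omega>)" .
    qed
    also have "\<dots> = (\<Sum>n. ennreal (2 powr (\<sigma> * real (Suc n))) * emeasure M {\<omega> \<in> space M. 2 ^ n \<le> W x \<omega>})"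
      by (subst nn_integral_suminf) (auto simp: nn_integral_cmult)
    also have "\<dots> = (\<Sum>n. ennreal (2 powr \<sigma> * q ^ n))"
    proof (intro suminf_cong)
      fix n
      have "emeasure M {\<omega> \<in> space M. 2 ^ n \<le> W x \<omega>} = ennreal ((2 ^ n) powr (1 - \<tau>))"
        using weight_tail[of "2 ^ n" x] by (simp add: emeasure_eq_measure)
      also have "(2 ^ n :: real) powr (1 - \<tau>) = 2 powr (real n * (1 - \<tau>))"
        by (simp add: powr_powr flip: powr_realpow)
      finally have "ennreal (2 powr (\<sigma> * real (Suc n))) * emeasure M {\<omega> \<in> space M. 2 ^ n \<le> W x \<omega>}
        = ennreal (2 powr (\<sigma> * real (Suc n) + real n * (1 - \<tau>)))"
        by (simp add: powr_add flip: ennreal_mult)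
      also have "2 powr (\<sigma> * real (Suc n) + real n * (1 - \<tau>)) = 2 powr \<sigma> * q ^ n"
        by (simp add: q_def powr_powr flip: powr_realpow powr_add) (simp add: algebra_simps)
      finally show "ennreal (2 powr (\<sigma> * real (Suc n))) * emeasure M {\<omega> \<in> space M. 2 ^ n \<le> W x \<omega>}
        = ennreal (2 powr \<sigma> * q ^ n)" .
    qed
    also have "\<dots> = ennreal (2 powr \<sigma> * (1 / (1 - q)))"
      using q by (intro suminf_ennreal_eq sums_mult geometric_sums) auto
    also have "\<dots> \<le> ennreal (max 1 (2 powr \<sigma> / (1 - q)))" by (intro ennreal_leI) auto
    finally show ?thesis .
  qed
  then show ?thesis by (intro that[of "max 1 (2 powr \<sigma> / (1 - q))"]) auto
qed

lemma edges_event [measurable]: "finite F \<Longrightarrow> {\<omega> \<in> space M. F \<subseteq> L \<omega>} \<in> events"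
proof -
  assume "finite F"
  have "{\<omega> \<in> space M. e \<in> L \<omega>} \<in> events" for e
    using edges_measurable[of "fst e" "snd e"] by simp
  then have "{\<omega> \<in> space M. \<forall>e\<in>F. e \<in> L \<omega>} \<in> events"
    using \<open>finite F\<close> by (intro sets.sets_Collect_finite_All) auto
  then show ?thesis by (simp add: subset_eq)
qed

lemma subalgebra_weight_algebra: "subalgebra M (weight_algebra M W)"
proof -
  have "(\<lambda>\<omega> x. W x \<omega>) \<in> measurable M (Pi\<^sub>M UNIV (\<lambda>_. borel))"
    by (rule measurable_PiM_single') (auto simp: space_PiM)
  moreover have "(\<lambda>\<omega> x. W x \<omega>) \<in> space M \<rightarrow> space (Pi\<^sub>M UNIV (\<lambda>_. borel :: real measure))"
    by (simp add: space_PiM)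
  ultimately show ?thesis
    unfolding subalgebra_def weight_algebra_def
    by (auto simp: sets_vimage_algebra2 dest: measurable_sets)
qed

text \<open>
  Taking expectations in the defining property of the conditional probabilities.
\<close>

lemma emeasure_edges:
  assumes "finite F" "asym F"
  shows "emeasure M {\<omega> \<in> space M. F \<subseteq> L \<omega>} =
    (\<integral>\<^sup>+\<omega>. ennreal (\<Prod>(x, y)\<in>F. conn_prob \<alpha> l (\<lambda>v. W v \<omega>) x y) \<partial>M)"
proof -
  let ?E = "{\<omega> \<in> space M. F \<subseteq> L \<omega>}" and ?c = "real_cond_exp M (weight_algebra M W) (indicator {\<omega> \<in> space M. F \<subseteq> L \<omega>})"
  let ?p = "\<lambda>\<omega>. (\<Prod>(x, y)\<in>F. conn_prob \<alpha> l (\<lambda>v. W v \<omega>) x y)"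
  interpret sub: finite_measure_subalgebra M "weight_algebra M W"
    by unfold_locales (rule subalgebra_weight_algebra)
  have int: "integrable M (indicator ?E :: 'a \<Rightarrow> real)"
    using edges_event[OF assms(1)] by (simp add: emeasure_eq_measure)
  have AE: "AE \<omega> in M. ?c \<omega> = ?p \<omega>" by (rule cond_edges[OF assms])
  have "emeasure M ?E = ennreal (\<integral>\<omega>. indicator ?E \<omega> \<partial>M)"
    using edges_event[OF assms(1)] by (simp add: emeasure_eq_measure)
  also have "\<dots> = ennreal (\<integral>\<omega>. ?c \<omega> \<partial>M)" using sub.real_cond_exp_int(2)[OF int] by simp
  also have "\<dots> = (\<integral>\<^sup>+\<omega>. ennreal (?c \<omega>) \<partial>M)"
  proof (rule nn_integral_eq_integral[symmetric])
    show "integrable M ?c" by (rule sub.real_cond_exp_int(1)[OF int])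
    show "AE \<omega> in M. 0 \<le> ?c \<omega>"
      using AE by eventually_elim (auto intro!: prod_nonneg simp: conn_prob_nonneg[OF l_pos])
  qed
  also have "\<dots> = (\<integral>\<^sup>+\<omega>. ennreal (?p \<omega>) \<partial>M)"
    using AE by (intro nn_integral_cong_AE) auto
  finally show ?thesis .
qed

text \<open>
  Edges with a common vertex are positively correlated through its weight. Since no load exceeds
  \<open>\<beta> + \<eta>\<close>, a moment of this order controls the weight of each vertex. There are at most two vertices
  per edge, so the moments are accounted for by a factor \<open>m\<^sup>2\<close> for each edge.
\<close>

lemma emeasure_admissible_le:
  assumes adm: "admissible \<beta> \<eta> s" and \<beta>: "0 \<le> \<beta>" "\<beta> \<le> \<alpha>" and \<eta>: "0 \<le> \<eta>" "\<eta> \<le> \<alpha>"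
    and m: "m \<ge> 1" "\<And>x. (\<integral>\<^sup>+\<omega>. ennreal (W x \<omega> powr (\<beta> + \<eta>)) \<partial>M) \<le> ennreal m"
  shows "emeasure M {\<omega> \<in> space M. \<forall>(h, u, v)\<in>set s. (u, v) \<in> L \<omega>} \<le> marked_weight (max 1 l * m\<^sup>2) \<beta> \<eta> s"
proof -
  define F where "F = set (map snd s)"
  define V where "V = (\<Union>(h, u, v)\<in>set s. {u, v})"
  let ?b = "\<lambda>(h, u, v). max 1 l * eucl u v powr - (real CARD('d) * (if h then \<beta> else \<eta>))"
  have fin: "finite F" "finite V" by (auto simp: F_def V_def)
  have cardV: "card V \<le> 2 * length s"
    unfolding V_def
  proof (induction s)
    case (Cons e s)
    obtain h u v where e: "e = (h, u, v)" by (cases e)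
    have "card ({u, v} \<union> (\<Union>(h, u, v)\<in>set s. {u, v})) \<le> card {u, v} + card (\<Union>(h, u, v)\<in>set s. {u, v})"
      by (rule card_Un_le)
    moreover have "card {u, v} \<le> 2" by (simp add: card_insert_if)
    ultimately show ?case using Cons by (simp add: e)
  qed simp
  have ends: "u \<noteq> v \<and> u \<in> V \<and> v \<in> V" if "(h, u, v) \<in> set s" for h u v
    using adm that by (fastforce simp: V_def admissible_def)
  have dist: "distinct (map (\<lambda>(h, u, v). {u, v}) s)" using adm by (simp add: admissible_def)
  have dist': "distinct (map snd s)"
  proof -
    have "map (\<lambda>(h, u, v). {u, v}) s = map (\<lambda>(u, v). {u, v}) (map snd s)" by auto
    then show ?thesis using dist by (metis distinct_map)
  qed
  have "asym F"
  proof (rule asymI)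
    fix u v assume "(u, v) \<in> F"
    then obtain h where h: "(h, u, v) \<in> set s" by (auto simp: F_def)
    show "(v, u) \<notin> F"
    proof
      assume "(v, u) \<in> F"
      then obtain h' where h': "(h', v, u) \<in> set s" by (auto simp: F_def)
      have "(h, u, v) = (h', v, u)"
        using dist h h' by (intro inj_onD[of "\<lambda>(h, u, v). {u, v}" "set s"]) (auto simp: distinct_map)
      then show False using ends[OF h] by simp
    qed
  qed
  have indep_V: "indep_vars (\<lambda>_. borel) W V" using indep_weights by (rule indep_vars_subset) auto
  have indep: "indep_vars (\<lambda>_. borel) (\<lambda>z \<omega>. ennreal (W z \<omega> powr (\<beta> + \<eta>))) V"
    by (rule indep_vars_compose2[OF indep_V, where Y = "\<lambda>_ w. ennreal (w powr (\<beta> + \<eta>))"]) auto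
  have "(\<integral>\<^sup>+\<omega>. (\<Prod>z\<in>V. ennreal (W z \<omega> powr (\<beta> + \<eta>))) \<partial>M) = (\<Prod>z\<in>V. \<integral>\<^sup>+\<omega>. ennreal (W z \<omega> powr (\<beta> + \<eta>)) \<partial>M)"
    by (rule indep_vars_nn_integral[OF fin(2) indep]) simp
  also have "\<dots> \<le> (\<Prod>z\<in>V. ennreal m)" by (intro prod_mono_ennreal m(2))
  also have "\<dots> = ennreal (m ^ card V)" using m by (simp add: prod_ennreal ennreal_power)
  also have "\<dots> \<le> ennreal (m ^ (2 * length s))"
    using m cardV by (intro ennreal_leI power_increasing) auto
  finally have moments: "(\<integral>\<^sup>+\<omega>. (\<Prod>z\<in>V. ennreal (W z \<omega> powr (\<beta> + \<eta>))) \<partial>M) \<le> ennreal (m ^ (2 * length s))" .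
  have "{\<omega> \<in> space M. \<forall>(h, u, v)\<in>set s. (u, v) \<in> L \<omega>} = {\<omega> \<in> space M. F \<subseteq> L \<omega>}"
    by (fastforce simp: F_def)
  then have "emeasure M {\<omega> \<in> space M. \<forall>(h, u, v)\<in>set s. (u, v) \<in> L \<omega>} =
      (\<integral>\<^sup>+\<omega>. ennreal (\<Prod>(x, y)\<in>F. conn_prob \<alpha> l (\<lambda>v. W v \<omega>) x y) \<partial>M)"
    using emeasure_edges[OF fin(1) \<open>asym F\<close>] by simp
  also have "\<dots> \<le> (\<integral>\<^sup>+\<omega>. ennreal (prod_list (map ?b s)) * (\<Prod>z\<in>V. ennreal (W z \<omega> powr (\<beta> + \<eta>))) \<partial>M)"
  proof (rule nn_integral_mono_AE)
    have "AE \<omega> in M. \<forall>z. 1 \<le> W z \<omega>" using AE_W_ge_1 by (simp add: AE_all_countable)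
    then show "AE \<omega> in M. ennreal (\<Prod>(x, y)\<in>F. conn_prob \<alpha> l (\<lambda>v. W v \<omega>) x y)
        \<le> ennreal (prod_list (map ?b s)) * (\<Prod>z\<in>V. ennreal (W z \<omega> powr (\<beta> + \<eta>)))"
    proof eventually_elim
      fix \<omega> assume \<omega>: "\<forall>z. 1 \<le> W z \<omega>"
      have b0: "0 \<le> prod_list (map ?b s)" by (intro prod_list_nonneg) auto
      have "(\<Prod>(x, y)\<in>F. conn_prob \<alpha> l (\<lambda>v. W v \<omega>) x y) = (\<Prod>(h, u, v)\<leftarrow>s. conn_prob \<alpha> l (\<lambda>v. W v \<omega>) u v)"
        unfolding F_def using dist' by (subst prod.distinct_set_conv_list) (simp_all add: o_def split_def)
      also have "\<dots> \<le> prod_list (map ?b s) * (\<Prod>z\<in>V. W z \<omega> powr load \<beta> \<eta> s z)"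
        using fin \<omega> l_pos \<beta> \<eta> ends by (intro prod_conn_prob_le) auto
      also have "\<dots> \<le> prod_list (map ?b s) * (\<Prod>z\<in>V. W z \<omega> powr (\<beta> + \<eta>))"
        using \<omega> adm b0 by (intro mult_left_mono prod_mono) (auto simp: admissible_def intro!: powr_mono)
      finally show "ennreal (\<Prod>(x, y)\<in>F. conn_prob \<alpha> l (\<lambda>v. W v \<omega>) x y)
        \<le> ennreal (prod_list (map ?b s)) * (\<Prod>z\<in>V. ennreal (W z \<omega> powr (\<beta> + \<eta>)))"
        using b0 by (simp add: prod_ennreal prod_nonneg ennreal_leI flip: ennreal_mult)
    qed
  qed
  also have "\<dots> = ennreal (prod_list (map ?b s)) * (\<integral>\<^sup>+\<omega>. (\<Prod>z\<in>V. ennreal (W z \<omega> powr (\<beta> + \<eta>))) \<partial>M)"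
    by (intro nn_integral_cmult) measurable
  also have "\<dots> \<le> ennreal (prod_list (map ?b s)) * ennreal (m ^ (2 * length s))"
    by (intro mult_left_mono moments) simp
  also have "ennreal (prod_list (map ?b s)) * ennreal (m ^ (2 * length s)) = marked_weight (max 1 l * m\<^sup>2) \<beta> \<eta> s"
  proof (induction s)
    case (Cons e s)
    obtain h u v where e: "e = (h, u, v)" by (cases e)
    have nn: "0 \<le> prod_list (map ?b s)" by (intro prod_list_nonneg) auto
    define B where "B = eucl u v powr - (real CARD('d) * (if h then \<beta> else \<eta>))"
    have "B \<ge> 0" by (simp add: B_def)
    have "ennreal (prod_list (map ?b (e # s))) * ennreal (m ^ (2 * length (e # s))) =
      ennreal (max 1 l * m\<^sup>2 * B) * (ennreal (prod_list (map ?b s)) * ennreal (m ^ (2 * length s)))"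
      using nn m \<open>B \<ge> 0\<close> by (simp add: e B_def[symmetric] power2_eq_square mult_ac flip: ennreal_mult)
    then show ?case by (simp add: Cons marked_weight_def e B_def)
  qed (simp add: marked_weight_def)
  finally show ?thesis .
qed

lemma union_bound:
  fixes T :: "(int ^ 'd) marked_edges set"
  assumes \<beta>: "0 \<le> \<beta>" "\<beta> \<le> \<alpha>" and \<eta>: "0 \<le> \<eta>" "\<eta> \<le> \<alpha>"
    and m: "m \<ge> 1" "\<And>x. (\<integral>\<^sup>+\<omega>. ennreal (W x \<omega> powr (\<beta> + \<eta>)) \<partial>M) \<le> ennreal m"
  shows "{\<omega> \<in> space M. \<exists>s\<in>T. admissible \<beta> \<eta> s \<and> (\<forall>(h, u, v)\<in>set s. (u, v) \<in> L \<omega>)} \<in> events"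
      (is "?X \<in> _")
    and "emeasure M {\<omega> \<in> space M. \<exists>s\<in>T. admissible \<beta> \<eta> s \<and> (\<forall>(h, u, v)\<in>set s. (u, v) \<in> L \<omega>)} \<le>
    mass (max 1 l * m\<^sup>2) \<beta> \<eta> T"
proof -
  define G where "G s = {\<omega> \<in> space M. \<forall>(h, u, v)\<in>set s. (u, v) \<in> L \<omega>}" for s :: "(int ^ 'd) marked_edges"
  let ?T = "{s \<in> T. admissible \<beta> \<eta> s}"
  have [measurable]: "G s \<in> events" for s
  proof -
    have "G s = {\<omega> \<in> space M. set (map snd s) \<subseteq> L \<omega>}" by (fastforce simp: G_def)
    then show ?thesis using edges_event[of "set (map snd s)"] by simp
  qed
  have eq: "{\<omega> \<in> space M. \<exists>s\<in>T. admissible \<beta> \<eta> s \<and> (\<forall>(h, u, v)\<in>set s. (u, v) \<in> L \<omega>)} = (\<Union>s\<in>?T. G s)"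
    by (auto simp: G_def)
  have "emeasure M (\<Union>s\<in>?T. G s) = (\<integral>\<^sup>+\<omega>. indicator (\<Union>s\<in>?T. G s) \<omega> \<partial>M)"
    by (intro nn_integral_indicator[symmetric] sets.countable_UN') auto
  also have "\<dots> \<le> (\<integral>\<^sup>+\<omega>. (\<integral>\<^sup>+s. indicator ?T s * indicator (G s) \<omega> \<partial>count_space UNIV) \<partial>M)"
  proof (rule nn_integral_mono)
    fix \<omega>
    show "indicator (\<Union>s\<in>?T. G s) \<omega> \<le> (\<integral>\<^sup>+s. indicator ?T s * indicator (G s) \<omega> \<partial>count_space UNIV)"
    proof (cases "\<omega> \<in> (\<Union>s\<in>?T. G s)")
      case True
      then obtain s where s: "s \<in> ?T" "\<omega> \<in> G s" by blast
      have "1 = (indicator ?T s * indicator (G s) \<omega> :: ennreal)" using s by simp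
      also have "\<dots> \<le> (\<integral>\<^sup>+s. indicator ?T s * indicator (G s) \<omega> \<partial>count_space UNIV)"
        by (rule nn_integral_ge_point) simp
      finally show ?thesis using True by simp
    qed simp
  qed
  also have "\<dots> = (\<integral>\<^sup>+s. (\<integral>\<^sup>+\<omega>. indicator ?T s * indicator (G s) \<omega> \<partial>M) \<partial>count_space UNIV)"
    by (intro nn_integral_count_space_nn_integral) auto
  also have "\<dots> = (\<integral>\<^sup>+s. indicator ?T s * emeasure M (G s) \<partial>count_space UNIV)"
    by (simp add: nn_integral_cmult)
  also have "\<dots> \<le> (\<integral>\<^sup>+s. marked_weight (max 1 l * m\<^sup>2) \<beta> \<eta> s * indicator T s \<partial>count_space UNIV)"
  proof (rule nn_integral_mono)
    fix s
    show "indicator ?T s * emeasure M (G s) \<le> marked_weight (max 1 l * m\<^sup>2) \<beta> \<eta> s * indicator T s"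
      using emeasure_admissible_le[OF _ \<beta> \<eta> m, of s] by (auto simp: G_def indicator_def)
  qed
  finally show "emeasure M ?X \<le> mass (max 1 l * m\<^sup>2) \<beta> \<eta> T"
    unfolding eq mass_def .
  show "?X \<in> events" unfolding eq by (intro sets.countable_UN') auto
qed

end

section \<open>The total weight of all skeletons\<close>

lemma nn_integral_count_space_swap:
  "(\<integral>\<^sup>+x. \<integral>\<^sup>+y. f x y \<partial>count_space UNIV \<partial>count_space UNIV) =
   (\<integral>\<^sup>+y. \<integral>\<^sup>+x. f x y \<partial>count_space UNIV \<partial>count_space UNIV)"
  using nn_integral_fst_count_space[of "\<lambda>(x, y). f x y"] nn_integral_snd_count_space[of "\<lambda>(x, y). f x y"]
  by simp

lemma marked_weight_Nil [simp]: "marked_weight A \<beta> \<eta> [] = 1"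
  by (simp add: marked_weight_def)

lemma marked_weight_append: "marked_weight A \<beta> \<eta> (s @ s') = marked_weight A \<beta> \<eta> s * marked_weight A \<beta> \<eta> s'"
  by (simp add: marked_weight_def)

lemma mass_mono: "T \<subseteq> T' \<Longrightarrow> mass A \<beta> \<eta> T \<le> mass A \<beta> \<eta> T'"
  unfolding mass_def by (intro nn_integral_mono mult_left_mono) (auto simp: indicator_def)

lemma mass_empty [simp]: "mass A \<beta> \<eta> {} = 0"
  by (simp add: mass_def)

lemma mass_single [simp]: "mass A \<beta> \<eta> {s} = marked_weight A \<beta> \<eta> s"
  by (simp add: mass_def)

lemma mass_Un_le: "mass A \<beta> \<eta> (T \<union> T') \<le> mass A \<beta> \<eta> T + mass A \<beta> \<eta> T'"
proof -
  have "mass A \<beta> \<eta> (T \<union> T') \<le> (\<integral>\<^sup>+s. marked_weight A \<beta> \<eta> s * indicator T s + marked_weight A \<beta> \<eta> s * indicator T' s \<partial>count_space UNIV)"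
    unfolding mass_def by (intro nn_integral_mono) (auto simp: indicator_def)
  also have "\<dots> = mass A \<beta> \<eta> T + mass A \<beta> \<eta> T'"
    unfolding mass_def by (intro nn_integral_add) auto
  finally show ?thesis .
qed

lemma mass_UN_le:
  assumes "T \<subseteq> (\<Union>i. B i)"
  shows "mass A \<beta> \<eta> T \<le> (\<integral>\<^sup>+i. mass A \<beta> \<eta> (B i) \<partial>count_space UNIV)"
proof -
  let ?w = "marked_weight A \<beta> \<eta>"
  have "mass A \<beta> \<eta> T \<le> (\<integral>\<^sup>+s. \<integral>\<^sup>+i. ?w s * indicator (B i) s \<partial>count_space UNIV \<partial>count_space UNIV)"
    unfolding mass_def
  proof (rule nn_integral_mono)
    fix s
    show "?w s * indicator T s \<le> (\<integral>\<^sup>+i. ?w s * indicator (B i) s \<partial>count_space UNIV)"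
    proof (cases "s \<in> T")
      case True
      then obtain i where "s \<in> B i" using assms by auto
      then have "?w s * indicator T s = ?w s * indicator (B i) s" using True by simp
      also have "\<dots> \<le> (\<integral>\<^sup>+i. ?w s * indicator (B i) s \<partial>count_space UNIV)"
        by (rule nn_integral_ge_point) simp
      finally show ?thesis .
    qed simp
  qed
  then show ?thesis unfolding mass_def by (subst nn_integral_count_space_swap)
qed

text \<open>
  The weight of a list of marked edges is multiplicative, so decomposing skeletons at an edge
  factorises their total weight.
\<close>

lemma mass_join_le:
  "mass A \<beta> \<eta> {s @ e # s' |s s'. s \<in> S \<and> s' \<in> S'} \<le> mass A \<beta> \<eta> S * marked_weight A \<beta> \<eta> [e] * mass A \<beta> \<eta> S'"
proof -
  let ?w = "marked_weight A \<beta> \<eta>"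
  let ?B = "\<lambda>s s'. if s \<in> S \<and> s' \<in> S' then {s @ e # s'} else {}"
  have "mass A \<beta> \<eta> {s @ e # s' |s s'. s \<in> S \<and> s' \<in> S'} \<le>
      (\<integral>\<^sup>+s. mass A \<beta> \<eta> (\<Union>s'. ?B s s') \<partial>count_space UNIV)"
    by (rule mass_UN_le) auto
  also have "\<dots> \<le> (\<integral>\<^sup>+s. \<integral>\<^sup>+s'. mass A \<beta> \<eta> (?B s s') \<partial>count_space UNIV \<partial>count_space UNIV)"
    by (intro nn_integral_mono mass_UN_le) auto
  also have "\<dots> = (\<integral>\<^sup>+s. \<integral>\<^sup>+s'. (?w s * indicator S s * ?w [e]) * (?w s' * indicator S' s') \<partial>count_space UNIV \<partial>count_space UNIV)"
  proof (intro nn_integral_cong)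
    fix s s'
    have "?w (s @ e # s') = ?w s * ?w [e] * ?w s'"
      using marked_weight_append[of A \<beta> \<eta> s "[e] @ s'"] marked_weight_append[of A \<beta> \<eta> "[e]" s']
      by (simp add: mult.assoc)
    then show "mass A \<beta> \<eta> (?B s s') = (?w s * indicator S s * ?w [e]) * (?w s' * indicator S' s')"
      by (simp add: indicator_def)
  qed
  also have "\<dots> = mass A \<beta> \<eta> S * ?w [e] * mass A \<beta> \<eta> S'"
    by (simp add: mass_def nn_integral_cmult nn_integral_multc)
  finally show ?thesis .
qed

lemma mass_snoc_le: "mass A \<beta> \<eta> {s @ [e] |s. s \<in> S} \<le> mass A \<beta> \<eta> S * marked_weight A \<beta> \<eta> [e]"
proof -
  have "{s @ [e] |s. s \<in> S} = {s @ e # s' |s s'. s \<in> S \<and> s' \<in> {[]}}" by auto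
  then show ?thesis using mass_join_le[of A \<beta> \<eta> e S "{[]}"] by simp
qed

lemma mass_UN_lessThan_le:
  "mass A \<beta> \<eta> (\<Union>n<N. B n) \<le> (\<Sum>n<(N::nat). mass A \<beta> \<eta> (B n))"
proof -
  let ?B = "\<lambda>n. if n < N then B n else {}"
  have "mass A \<beta> \<eta> (\<Union>n<N. B n) \<le> (\<integral>\<^sup>+n. mass A \<beta> \<eta> (?B n) \<partial>count_space UNIV)"
    by (rule mass_UN_le) auto
  also have "\<dots> = (\<Sum>n<N. mass A \<beta> \<eta> (?B n))" by (rule nn_integral_count_space') auto
  finally show ?thesis by simp
qed

text \<open>
  Beyond distance \<open>R n\<close>, the long edge contributes at most \<open>A * (n / |x - y|)\<^bsup>d\<beta>\<^esup>\<close>, regardless of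
  its position. The remaining sums over the positions of its two ends decouple into two arms. By
  induction, the arms with \<open>m\<close> edges have total weight of order \<open>R m\<^sup>d\<close>, the number of points in a
  ball of radius \<open>R m\<close>: their last edge costs only the constant \<open>C\<eta>\<close>, because \<open>\<eta>\<close> is a summable
  exponent. Thus the claim carries over to \<open>n\<close> if \<open>R n\<close> dominates the products \<open>R m * R m'\<close> in the
  sense of the last assumption.
\<close>

lemma skeleton_mass_le:
  fixes x y :: "int ^ 'd"
  defines "d \<equiv> real CARD('d)"
  assumes A: "0 \<le> A" and R: "mono R" "\<And>n. 1 \<le> R n"
    and C\<beta>: "0 \<le> C\<beta>" "\<And>(x :: int ^ 'd) r. 1 \<le> r \<Longrightarrow>
      (\<integral>\<^sup>+y. ennreal (decay (d * \<beta>) r (eucl x y)) \<partial>count_space UNIV) \<le> ennreal (C\<beta> * r ^ CARD('d))"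
    and C\<eta>: "0 \<le> C\<eta>" "\<And>x :: int ^ 'd.
      (\<integral>\<^sup>+y. ennreal (decay (d * \<eta>) 1 (eucl x y)) \<partial>count_space UNIV) \<le> ennreal C\<eta>"
    and K: "1 \<le> K" "C\<beta> * C\<eta> * (1 + A) \<le> K"
    and \<beta>: "0 < \<beta>"
    and rec: "\<And>m n. m < n \<Longrightarrow>
      A * K\<^sup>2 * real n powr (d * \<beta> + 1) * (R m * R (n - 1 - m)) powr d \<le> R n powr (d * \<beta>)"
  shows "mass A \<beta> \<eta> {s. skeleton R n x y s} \<le> ennreal (decay (d * \<beta>) (R n) (eucl x y))"
proof (induction n arbitrary: x y rule: less_induct)
  case (less n)
  let ?S = "\<lambda>n x y. {s. skeleton R n x y s}" and ?A = "\<lambda>m x u. {s. arm R m x u s}"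
  let ?mass = "mass A \<beta> \<eta> :: (int ^ 'd) marked_edges set \<Rightarrow> ennreal"
  have Rd: "1 \<le> R m ^ CARD('d)" for m using R(2)[of m] by (rule one_le_power)
  have arm: "(\<integral>\<^sup>+u. ?mass (?A m x u) \<partial>count_space UNIV) \<le> ennreal (K * R m ^ CARD('d))" if "m < n" for m x
  proof (cases m)
    case 0
    have "(\<integral>\<^sup>+u. ?mass (?A m x u) \<partial>count_space UNIV) \<le> (\<integral>\<^sup>+u. 1 * indicator {x} u \<partial>count_space UNIV)"
    proof (rule nn_integral_mono)
      fix u
      have "?A m x u \<subseteq> (if u = x then {[]} else {})" unfolding 0 by (auto elim: arm.cases)
      then have "?mass (?A m x u) \<le> ?mass (if u = x then {[]} else {})" by (rule mass_mono)
      then show "?mass (?A m x u) \<le> 1 * indicator {x} u" by (auto simp: indicator_def split: if_splits)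
    qed
    also have "\<dots> = ennreal 1" by simp
    also have "\<dots> \<le> ennreal (K * R m ^ CARD('d))"
      using mult_mono[OF K(1) Rd[of m]] K by (intro ennreal_leI) auto
    finally show ?thesis .
  next
    case (Suc k)
    \<comment> \<open>The last step of an arm, from \<open>u'\<close> to \<open>u\<close>: the summand \<open>1\<close> stands for a grid edge, \<open>A\<close> for a recorded edge.\<close>
    let ?D = "\<lambda>u' u. ennreal (1 + A) * ennreal (decay (d * \<eta>) 1 (eucl u' u))"
    have "?mass (?A m x u) \<le> (\<integral>\<^sup>+u'. ?mass (?S k x u') * ?D u' u \<partial>count_space UNIV)" for u
    proof -
      let ?B1 = "\<lambda>u'. if eucl u' u = 1 then ?S k x u' else {}"
      let ?B2 = "\<lambda>u'. if u' \<noteq> u then {s @ [(False, u', u)] |s. s \<in> ?S k x u'} else {}"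
      have "?A m x u \<subseteq> (\<Union>u'. ?B1 u' \<union> ?B2 u')" unfolding Suc
        by (auto elim!: arm.cases split: if_splits)
      then have "?mass (?A m x u) \<le> (\<integral>\<^sup>+u'. ?mass (?B1 u' \<union> ?B2 u') \<partial>count_space UNIV)"
        by (rule mass_UN_le)
      also have "\<dots> \<le> (\<integral>\<^sup>+u'. ?mass (?S k x u') * ?D u' u \<partial>count_space UNIV)"
      proof (rule nn_integral_mono)
        fix u'
        show "?mass (?B1 u' \<union> ?B2 u') \<le> ?mass (?S k x u') * ?D u' u"
        proof (cases "u' = u")
          case False
          define D where "D = eucl u' u powr - (d * \<eta>)"
          have e: "1 \<le> eucl u' u" using False by (rule eucl_ge_1)
          have D: "decay (d * \<eta>) 1 (eucl u' u) = D" "0 \<le> D"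
            using e by (auto simp: D_def decay_def powr_divide powr_minus field_simps)
          have D1: "D = 1" if "eucl u' u = 1" using that by (simp add: D_def)
          have "?mass (?B1 u') \<le> ?mass (?S k x u') * ennreal D"
            using D1 by auto
          moreover have "?mass (?B2 u') \<le> ?mass (?S k x u') * ennreal (A * D)"
            using mass_snoc_le[of A \<beta> \<eta> "(False, u', u)" "?S k x u'"] False
            by (simp add: marked_weight_def D_def d_def)
          ultimately have "?mass (?B1 u' \<union> ?B2 u') \<le> ?mass (?S k x u') * ennreal D + ?mass (?S k x u') * ennreal (A * D)"
            by (rule order_trans[OF mass_Un_le add_mono])
          also have "\<dots> = ?mass (?S k x u') * ?D u' u"
            using A D(2) by (simp add: D(1) distrib_left[symmetric] flip: ennreal_plus ennreal_mult) (simp add: algebra_simps)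
          finally show ?thesis .
        qed simp
      qed
      finally show ?thesis .
    qed
    then have "(\<integral>\<^sup>+u. ?mass (?A m x u) \<partial>count_space UNIV) \<le>
        (\<integral>\<^sup>+u. \<integral>\<^sup>+u'. ?mass (?S k x u') * ?D u' u \<partial>count_space UNIV \<partial>count_space UNIV)"
      by (intro nn_integral_mono)
    also have "\<dots> = (\<integral>\<^sup>+u'. \<integral>\<^sup>+u. ?mass (?S k x u') * ?D u' u \<partial>count_space UNIV \<partial>count_space UNIV)"
      by (rule nn_integral_count_space_swap)
    also have "\<dots> = (\<integral>\<^sup>+u'. ?mass (?S k x u') * (ennreal (1 + A) * (\<integral>\<^sup>+u. ennreal (decay (d * \<eta>) 1 (eucl u' u)) \<partial>count_space UNIV)) \<partial>count_space UNIV)"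
      by (simp add: nn_integral_cmult)
    also have "\<dots> \<le> (\<integral>\<^sup>+u'. ennreal (decay (d * \<beta>) (R k) (eucl x u')) * (ennreal (1 + A) * ennreal C\<eta>) \<partial>count_space UNIV)"
      using less.IH[of k] that Suc by (intro nn_integral_mono mult_mono C\<eta>) auto
    also have "\<dots> = (\<integral>\<^sup>+u'. ennreal (decay (d * \<beta>) (R k) (eucl x u')) \<partial>count_space UNIV) * (ennreal (1 + A) * ennreal C\<eta>)"
      by (rule nn_integral_multc) simp
    also have "\<dots> \<le> ennreal (C\<beta> * R k ^ CARD('d)) * (ennreal (1 + A) * ennreal C\<eta>)"
      by (intro mult_right_mono C\<beta> R) simp
    also have "\<dots> = ennreal (C\<beta> * C\<eta> * (1 + A) * R k ^ CARD('d))"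
    proof -
      have "0 \<le> R k ^ CARD('d)" using Rd[of k] by linarith
      then show ?thesis
        using A C\<beta>(1) C\<eta>(1) by (simp add: mult_ac ennreal_mult[symmetric] del: ennreal_plus)
    qed
    also have "\<dots> \<le> ennreal (K * R m ^ CARD('d))"
    proof (intro ennreal_leI mult_mono power_mono)
      show "R k \<le> R m" using R(1) Suc by (simp add: monoD)
      show "0 \<le> R k" using R(2)[of k] by linarith
    qed (use K Rd[of k] in auto)
    finally show ?thesis .
  qed
  show ?case
  proof (cases "eucl x y \<le> R n")
    case True
    then have "?S n x y \<subseteq> {[]}" by (auto elim: skeleton.cases)
    then have "?mass (?S n x y) \<le> ?mass {[]}" by (rule mass_mono)
    then show ?thesis using True by (simp add: decay_def)
  next
    case False
    define r where "r = eucl x y"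
    have r: "R n < r" "0 < r" using False R(2)[of n] by (auto simp: r_def)
    \<comment> \<open>The largest possible weight of the long edge.\<close>
    define q where "q = A * (r / real n) powr - (d * \<beta>)"
    define B where "B m u v = (if m < n \<and> r \<le> real n * eucl u v then
      {s @ (True, u, v) # s' |s s'. s \<in> ?A m x u \<and> s' \<in> ?A (n - 1 - m) y v} else {})" for m u v
    have sub: "?S n x y \<subseteq> (\<Union>m. \<Union>u. \<Union>v. B m u v)"
    proof
      fix s assume "s \<in> ?S n x y"
      then have "skeleton R n x y s" by simp
      then show "s \<in> (\<Union>m. \<Union>u. \<Union>v. B m u v)"
      proof cases
        case short
        then show ?thesis using False by simp
      next
        case (split m m' u v s1 s2)
        then have "s \<in> B m u v" by (auto simp: B_def r_def)
        then show ?thesis by blast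
      qed
    qed
    have "?mass (?S n x y) \<le> (\<integral>\<^sup>+m. ?mass (\<Union>u. \<Union>v. B m u v) \<partial>count_space UNIV)"
      using sub by (rule mass_UN_le)
    also have "\<dots> = (\<Sum>m<n. ?mass (\<Union>u. \<Union>v. B m u v))"
      by (rule nn_integral_count_space') (auto simp: B_def)
    also have "\<dots> \<le> (\<Sum>m<n. ennreal ((R n / r) powr (d * \<beta>) / real n))"
    proof (rule sum_mono)
      fix m assume "m \<in> {..<n}"
      then have m: "m < n" "n > 0" by auto
      have q: "q \<ge> 0" using A by (simp add: q_def)
      have "?mass (\<Union>u. \<Union>v. B m u v) \<le> (\<integral>\<^sup>+u. ?mass (\<Union>v. B m u v) \<partial>count_space UNIV)"
        by (rule mass_UN_le) simp
      also have "\<dots> \<le> (\<integral>\<^sup>+u. \<integral>\<^sup>+v. ?mass (B m u v) \<partial>count_space UNIV \<partial>count_space UNIV)"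
        by (intro nn_integral_mono mass_UN_le) simp
      also have "\<dots> \<le> (\<integral>\<^sup>+u. \<integral>\<^sup>+v. (?mass (?A m x u) * ennreal q) * ?mass (?A (n - 1 - m) y v) \<partial>count_space UNIV \<partial>count_space UNIV)"
      proof (intro nn_integral_mono)
        fix u v
        show "?mass (B m u v) \<le> (?mass (?A m x u) * ennreal q) * ?mass (?A (n - 1 - m) y v)"
        proof (cases "r \<le> real n * eucl u v")
          case True
          then have "r / real n \<le> eucl u v" using m by (simp add: field_simps)
          then have "A * eucl u v powr - (d * \<beta>) \<le> q"
            unfolding q_def using A r m \<beta> by (intro mult_left_mono powr_mono2') (auto simp: d_def)
          then have "marked_weight A \<beta> \<eta> [(True, u, v)] \<le> ennreal q"
            by (auto simp: marked_weight_def d_def intro!: ennreal_leI)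
          moreover have "?mass (B m u v) \<le> ?mass (?A m x u) * marked_weight A \<beta> \<eta> [(True, u, v)] * ?mass (?A (n - 1 - m) y v)"
            using mass_join_le[of A \<beta> \<eta> "(True, u, v)" "?A m x u" "?A (n - 1 - m) y v"] m True by (simp add: B_def)
          ultimately show ?thesis
            by (meson mult_left_mono mult_right_mono order_trans zero_le)
        qed (simp add: B_def)
      qed
      also have "\<dots> = (\<integral>\<^sup>+u. ?mass (?A m x u) \<partial>count_space UNIV) * ennreal q * (\<integral>\<^sup>+v. ?mass (?A (n - 1 - m) y v) \<partial>count_space UNIV)"
        by (simp add: nn_integral_cmult nn_integral_multc)
      also have "\<dots> \<le> ennreal (K * R m ^ CARD('d)) * ennreal q * ennreal (K * R (n - 1 - m) ^ CARD('d))"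
        using m by (intro mult_mono arm) auto
      also have "\<dots> = ennreal (K * R m ^ CARD('d) * q * (K * R (n - 1 - m) ^ CARD('d)))"
      proof -
        have "0 \<le> R m ^ CARD('d)" "0 \<le> R (n - 1 - m) ^ CARD('d)"
          using Rd[of m] Rd[of "n - 1 - m"] by linarith+
        then show ?thesis using q K by (simp flip: ennreal_mult)
      qed
      also have "\<dots> \<le> ennreal ((R n / r) powr (d * \<beta>) / real n)"
      proof (rule ennreal_leI)
        have pos: "0 < R m" "0 < R (n - 1 - m)" "0 < R n" using R(2) by (meson less_le_trans zero_less_one)+
        have "K * R m ^ CARD('d) * q * (K * R (n - 1 - m) ^ CARD('d)) =
          (A * K\<^sup>2 * real n powr (d * \<beta> + 1) * (R m * R (n - 1 - m)) powr d) * (r powr - (d * \<beta>) / real n)"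
        proof -
          have "(R m * R (n - 1 - m)) powr d = R m ^ CARD('d) * R (n - 1 - m) ^ CARD('d)"
            using pos by (simp add: d_def powr_realpow power_mult_distrib)
          moreover have "q = A * r powr - (d * \<beta>) * real n powr (d * \<beta>)"
            using r m by (simp add: q_def powr_divide powr_minus field_simps)
          moreover have "real n powr (d * \<beta> + 1) = real n powr (d * \<beta>) * real n"
            using m by (simp add: powr_add)
          ultimately show ?thesis using m by (simp add: power2_eq_square field_simps)
        qed
        also have "\<dots> \<le> R n powr (d * \<beta>) * (r powr - (d * \<beta>) / real n)"
          using rec[OF m(1)] by (intro mult_right_mono) auto
        also have "\<dots> = (R n / r) powr (d * \<beta>) / real n"
          using r pos by (simp add: powr_divide powr_minus field_simps)
        finally show "K * R m ^ CARD('d) * q * (K * R (n - 1 - m) ^ CARD('d)) \<le> (R n / r) powr (d * \<beta>) / real n" .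
      qed
      finally show "?mass (\<Union>u. \<Union>v. B m u v) \<le> ennreal ((R n / r) powr (d * \<beta>) / real n)" .
    qed
    also have "\<dots> = ennreal (\<Sum>m<n. (R n / r) powr (d * \<beta>) / real n)" by (rule sum_ennreal) simp
    also have "\<dots> \<le> ennreal (decay (d * \<beta>) (R n) (eucl x y))"
      using r by (intro ennreal_leI) (simp add: decay_def r_def)
    finally show ?thesis .
  qed
qed

section \<open>The lower bound on graph distances\<close>

context scale_free_percolation
begin

lemma walk_event: "{\<omega> \<in> space M. (x, y) \<in> sfp_graph L \<omega> ^^ n} \<in> events"
proof (induction n arbitrary: y)
  case 0
  then show ?case by (cases "x = y") auto
next
  case (Suc n)
  have step: "{\<omega> \<in> space M. (z, y) \<in> sfp_graph L \<omega>} \<in> events" for z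
    using edges_measurable[of z y] by (cases "(z, y) \<in> grid_edges") (auto simp: sfp_graph_def)
  have "{\<omega> \<in> space M. (x, y) \<in> sfp_graph L \<omega> ^^ Suc n} =
    (\<Union>z. {\<omega> \<in> space M. (x, z) \<in> sfp_graph L \<omega> ^^ n} \<inter> {\<omega> \<in> space M. (z, y) \<in> sfp_graph L \<omega>})"
    by auto
  also have "\<dots> \<in> events"
  proof (rule sets.countable_UN'')
    show "{\<omega> \<in> space M. (x, z) \<in> sfp_graph L \<omega> ^^ n} \<inter> {\<omega> \<in> space M. (z, y) \<in> sfp_graph L \<omega>} \<in> events" for z
      by (intro sets.Int Suc.IH step)
  qed auto
  finally show ?case .
qed

lemma graph_dist_event:
  "{\<omega> \<in> space M. ereal b \<le> ereal_of_enat (graph_dist (sfp_graph L \<omega>) x y)} \<in> events"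
proof -
  have "{\<omega> \<in> space M. ereal b \<le> ereal_of_enat (graph_dist (sfp_graph L \<omega>) x y)} =
    space M - (\<Union>n\<in>{n. real n < b}. {\<omega> \<in> space M. (x, y) \<in> sfp_graph L \<omega> ^^ n})"
    by (auto simp: le_graph_dist_iff not_le)
  also have "\<dots> \<in> events" by (intro sets.Diff sets.top sets.countable_UN'' walk_event) auto
  finally show ?thesis .
qed

text \<open>
  The union bound over skeletons, with radii for which the recursion closes up. Only walks with fewer
  than \<open>b\<close> edges matter, that is, lengths \<open>n < \<lceil>b\<rceil>\<close>.
\<close>

lemma prob_short_path_le:
  assumes \<beta>: "1 < \<beta>" "\<beta> < 2" "\<beta> \<le> \<alpha>" and \<eta>: "1 < \<eta>" "\<eta> \<le> \<beta>" and \<tau>: "\<beta> + \<eta> < \<tau> - 1"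
  obtains R C where "C > 0" "\<And>n. R n \<ge> 1" "\<And>n. ln (R n) \<le> C * real (n + 1) powr log 2 (2 / \<beta>)"
    "\<And>x y b. 1 - (\<Sum>n<nat \<lceil>b\<rceil>. decay (real CARD('d) * \<beta>) (R n) (eucl x y)) \<le>
      prob {\<omega> \<in> space M. ereal b \<le> ereal_of_enat (graph_dist (sfp_graph L \<omega>) x y)}"
proof -
  define d where "d = real CARD('d)"
  have d: "1 \<le> d" by (simp add: d_def Suc_leI)
  obtain m where m: "m \<ge> 1" "\<And>x. (\<integral>\<^sup>+\<omega>. ennreal (W x \<omega> powr (\<beta> + \<eta>)) \<partial>M) \<le> ennreal m"
    using weight_moment_bounded[of "\<beta> + \<eta>"] \<beta> \<eta> \<tau> by auto
  define A where "A = max 1 l * m\<^sup>2"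
  have A: "A > 0" using m by (simp add: A_def zero_less_mult_iff max_def)
  have "d * \<beta> > real CARD('d)" "d * \<eta> > real CARD('d)"
    using \<beta> \<eta> d by (simp_all add: d_def)
  then obtain C\<beta> C\<eta> where C\<beta>: "C\<beta> \<ge> 1" "\<And>(x :: int ^ 'd) r. r \<ge> 1 \<Longrightarrow>
      (\<integral>\<^sup>+y. ennreal (decay (d * \<beta>) r (eucl x y)) \<partial>count_space UNIV) \<le> ennreal (C\<beta> * r ^ CARD('d))"
    and C\<eta>: "C\<eta> \<ge> 1" "\<And>(x :: int ^ 'd) r. r \<ge> 1 \<Longrightarrow>
      (\<integral>\<^sup>+y. ennreal (decay (d * \<eta>) r (eucl x y)) \<partial>count_space UNIV) \<le> ennreal (C\<eta> * r ^ CARD('d))"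
    using decay_sum_bounded[of "d * \<beta>", where 'd = 'd] decay_sum_bounded[of "d * \<eta>", where 'd = 'd] by metis
  define K where "K = max 1 (C\<beta> * C\<eta> * (1 + A))"
  have K: "K \<ge> 1" "C\<beta> * C\<eta> * (1 + A) \<le> K" by (auto simp: K_def)
  define s where "s = log 2 (2 / \<beta>)"
  have s: "s = 1 - log 2 \<beta>" using \<beta> by (simp add: s_def log_divide)
  have "0 < log 2 \<beta>" "log 2 \<beta> < 1" using \<beta> by (auto simp: log_less_iff)
  then have s01: "0 < s" "s < 1" by (auto simp: s)
  have \<beta>_eq: "\<beta> = 2 powr (1 - s)" using \<beta> by (simp add: s)
  have AK: "A * K\<^sup>2 > 0" using A K by simp
  have D: "d * \<beta> + 1 \<ge> 0" using d \<beta> by (simp add: add_nonneg_nonneg)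
  obtain R C where R: "C > 0" "mono R" "\<And>n. R n \<ge> 1" "\<And>n. R n \<ge> real n"
    "\<And>m n. m < n \<Longrightarrow> A * K\<^sup>2 * real n powr (d * \<beta> + 1) * (R m * R (n - 1 - m)) powr d \<le> R n powr (d * \<beta>)"
    "\<And>n. ln (R n) \<le> C * real (n + 1) powr s"
    using radii_exist[OF s01 \<beta>_eq d D AK] by metis
  have mass_le: "mass A \<beta> \<eta> {s. skeleton R n x y s} \<le> ennreal (decay (d * \<beta>) (R n) (eucl x y))" for n and x y :: "int ^ 'd"
    unfolding d_def
  proof (rule skeleton_mass_le[where K = K and C\<beta> = C\<beta> and C\<eta> = C\<eta>], goal_cases)
    case (7 x)
    then show ?case using C\<eta>(2)[of 1 x] by (simp add: d_def)
  qed (use A R K C\<beta> C\<eta>(1) \<beta> in \<open>simp_all add: d_def\<close>)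
  have "1 - (\<Sum>n<nat \<lceil>b\<rceil>. decay (d * \<beta>) (R n) (eucl x y)) \<le>
      prob {\<omega> \<in> space M. ereal b \<le> ereal_of_enat (graph_dist (sfp_graph L \<omega>) x y)}" (is "_ \<le> prob ?E") for x y b
  proof -
    let ?T = "\<Union>n<nat \<lceil>b\<rceil>. {s. skeleton R n x y s}"
    let ?X = "{\<omega> \<in> space M. \<exists>s\<in>?T. admissible \<beta> \<eta> s \<and> (\<forall>(h, u, v)\<in>set s. (u, v) \<in> L \<omega>)}"
    have X: "?X \<in> events" "emeasure M ?X \<le> mass A \<beta> \<eta> ?T"
    proof -
      have hyps: "0 \<le> \<beta>" "\<beta> \<le> \<alpha>" "0 \<le> \<eta>" "\<eta> \<le> \<alpha>" using \<beta> \<eta> by auto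
      show "?X \<in> events" by (rule union_bound(1)[OF hyps m])
      show "emeasure M ?X \<le> mass A \<beta> \<eta> ?T" unfolding A_def by (rule union_bound(2)[OF hyps m])
    qed
    have "space M - ?E \<subseteq> ?X"
    proof
      fix \<omega> assume \<omega>: "\<omega> \<in> space M - ?E"
      then have "\<exists>n s. real n < b \<and> skeleton R n x y s \<and> admissible \<beta> \<eta> s \<and> (\<forall>(h, u, v)\<in>set s. (u, v) \<in> L \<omega>)"
        using \<beta> \<eta> R by (intro skeleton_of_close_pair edges_sym) (auto simp: sfp_graph_def)
      then obtain n s where n: "real n < b" "skeleton R n x y s" "admissible \<beta> \<eta> s" "\<forall>(h, u, v)\<in>set s. (u, v) \<in> L \<omega>"
        by blast
      have "n < nat \<lceil>b\<rceil>" using n(1) by linarith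
      then show "\<omega> \<in> ?X" using n \<omega> by blast
    qed
    then have "emeasure M (space M - ?E) \<le> emeasure M ?X" using X(1) by (rule emeasure_mono)
    also have "\<dots> \<le> (\<Sum>n<nat \<lceil>b\<rceil>. mass A \<beta> \<eta> {s. skeleton R n x y s})"
      using X(2) mass_UN_lessThan_le by (rule order_trans)
    also have "\<dots> \<le> (\<Sum>n<nat \<lceil>b\<rceil>. ennreal (decay (d * \<beta>) (R n) (eucl x y)))"
      by (intro sum_mono mass_le)
    also have "\<dots> = ennreal (\<Sum>n<nat \<lceil>b\<rceil>. decay (d * \<beta>) (R n) (eucl x y))" by (rule sum_ennreal) simp
    finally have "prob (space M - ?E) \<le> (\<Sum>n<nat \<lceil>b\<rceil>. decay (d * \<beta>) (R n) (eucl x y))"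
      by (simp add: emeasure_eq_measure sum_nonneg)
    then show ?thesis using prob_compl[OF graph_dist_event[of b x y]] by simp
  qed
  then show ?thesis using R by (intro that[of C R]) (auto simp: d_def s_def)
qed

text \<open>
  As \<open>ln (R n)\<close> is of order \<open>n\<^sup>s\<close> with \<open>s = 1 / \<Delta> \<beta>\<close>, walks with at most a small multiple of
  \<open>(ln r)\<^bsup>\<Delta> \<beta>\<^esup>\<close> edges have \<open>R n \<le> sqrt r\<close>. Each of these lengths then has probability at most
  \<open>r\<^bsup>-d\<beta>/2\<^esup>\<close>, and there are only polylogarithmically many of them.
\<close>

lemma graph_dist_lower_bound:
  assumes \<beta>: "1 < \<beta>" "\<beta> < 2" "\<beta> \<le> \<alpha>" and \<eta>: "1 < \<eta>" "\<eta> \<le> \<beta>" and \<tau>: "\<beta> + \<eta> < \<tau> - 1"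
  obtains c where "c > 0"
    "((\<lambda>(x, y). prob {\<omega> \<in> space M. ereal (c * ln (eucl x y) powr \<Delta> \<beta>) \<le>
        ereal_of_enat (graph_dist (sfp_graph L \<omega>) x y)}) \<longlongrightarrow> 1) far_pairs"
proof -
  obtain R C where C: "C > 0" and R1: "\<And>n. R n \<ge> 1"
    and lnR: "\<And>n. ln (R n) \<le> C * real (n + 1) powr log 2 (2 / \<beta>)"
    and prob_ge: "\<And>x y b. 1 - (\<Sum>n<nat \<lceil>b\<rceil>. decay (real CARD('d) * \<beta>) (R n) (eucl x y)) \<le>
      prob {\<omega> \<in> space M. ereal b \<le> ereal_of_enat (graph_dist (sfp_graph L \<omega>) x y)}"
    by (rule prob_short_path_le[OF assms]) blast
  define s where "s = log 2 (2 / \<beta>)"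
  have s: "s > 0" using \<beta> by (simp add: s_def)
  have \<Delta>: "\<Delta> \<beta> = 1 / s" by (simp add: \<Delta>_def s_def)
  \<comment> \<open>The value for which \<open>C * (2 * c)\<^sup>s = 1 / 2\<close>, so that \<open>R n \<le> sqrt r\<close> for all relevant \<open>n\<close>.\<close>
  define c where "c = (1 / (2 * C)) powr (1 / s) / 2"
  have c: "c > 0" using C by (simp add: c_def)
  have Cc: "C * (2 * c) powr s = 1 / 2" using C s by (simp add: c_def powr_powr)
  define b where "b r = c * ln r powr (1 / s)" for r
  define p where "p = real CARD('d) * \<beta>"
  have p: "p > 0" using \<beta> by (simp add: p_def)
  have bound: "(\<Sum>n<nat \<lceil>b r\<rceil>. decay p (R n) r) \<le> 2 * b r * r powr (- p / 2)"
    if r: "r > 1" "b r \<ge> 1" for r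
  proof -
    have N: "real (nat \<lceil>b r\<rceil>) \<le> 2 * b r" using r by linarith
    have "decay p (R n) r \<le> r powr (- p / 2)" if n: "n < nat \<lceil>b r\<rceil>" for n
    proof -
      have "real (n + 1) \<le> 2 * b r" using n N by linarith
      then have "real (n + 1) powr s \<le> (2 * b r) powr s" using s by (intro powr_mono2) auto
      also have "\<dots> = (2 * c) powr s * ln r"
        using r c s by (simp add: b_def powr_mult powr_powr)
      finally have "C * real (n + 1) powr s \<le> C * ((2 * c) powr s * ln r)"
        using C by (intro mult_left_mono) auto
      then have "ln (R n) \<le> ln r / 2" using lnR[of n] Cc by (simp add: s_def[symmetric] mult.assoc[symmetric])
      then have "exp (ln (R n)) \<le> exp (ln r / 2)" by (simp only: exp_le_cancel_iff)
      then have R: "R n \<le> r powr (1 / 2)" using R1[of n] r by (simp add: powr_def)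
      have "r powr (1 / 2) < r powr 1" using r by (intro powr_less_mono) auto
      then have "R n < r" using R r by simp
      then have "decay p (R n) r = (R n / r) powr p" by (simp add: decay_def)
      also have "\<dots> \<le> (r powr (1 / 2) / r) powr p"
        using R R1[of n] r p by (intro powr_mono2 divide_right_mono) auto
      also have "r powr (1 / 2) / r = r powr (- 1 / 2)"
        using r powr_diff[of r "1 / 2" 1] by simp
      also have "(r powr (- 1 / 2)) powr p = r powr (- p / 2)" by (simp add: powr_powr)
      finally show ?thesis .
    qed
    then have "(\<Sum>n<nat \<lceil>b r\<rceil>. decay p (R n) r) \<le> real (nat \<lceil>b r\<rceil>) * r powr (- p / 2)"
      using sum_bounded_above[of "{..<nat \<lceil>b r\<rceil>}" "\<lambda>n. decay p (R n) r"] by auto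
    also have "\<dots> \<le> 2 * b r * r powr (- p / 2)" using N by (rule mult_right_mono) simp
    finally show ?thesis .
  qed
  have far: "filterlim (\<lambda>(x, y). eucl x y) at_top (far_pairs :: ((int ^ 'd) \<times> (int ^ 'd)) filter)"
    unfolding far_pairs_def by (rule filterlim_filtercomap)
  \<comment> \<open>The power of \<open>r\<close> bounding \<open>ln r\<close>; after raising it to \<open>1 / s\<close> half of the decay is left.\<close>
  define a where "a = p * s / 4"
  have a: "a > 0" using p s by (simp add: a_def)
  have bound': "2 * b r * r powr (- p / 2) \<le> 2 * c * (1 / a) powr (1 / s) * r powr (- p / 4)" if r: "r > 1" for r
  proof -
    have "ln r powr (1 / s) \<le> (r powr a / a) powr (1 / s)"
      using r s a by (intro powr_mono2 ln_powr_bound) auto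
    also have "\<dots> = (1 / a) powr (1 / s) * r powr (p / 4)"
      using s a by (simp add: powr_divide powr_powr) (simp add: a_def)
    finally have "2 * (c * ln r powr (1 / s)) * r powr (- p / 2) \<le>
        2 * (c * ((1 / a) powr (1 / s) * r powr (p / 4))) * r powr (- p / 2)"
      using c by (intro mult_right_mono mult_left_mono) auto
    also have "\<dots> = 2 * c * (1 / a) powr (1 / s) * (r powr (p / 4) * r powr (- p / 2))" by simp
    also have "r powr (p / 4) * r powr (- p / 2) = r powr (- p / 4)" by (simp flip: powr_add)
    finally show ?thesis by (simp add: b_def)
  qed
  have "((\<lambda>r::real. r powr (- p / 4)) \<longlongrightarrow> 0) at_top"
    using p by (intro tendsto_neg_powr filterlim_ident) auto
  then have "((\<lambda>r. 1 - 2 * c * (1 / a) powr (1 / s) * r powr (- p / 4)) \<longlongrightarrow>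
      1 - 2 * c * (1 / a) powr (1 / s) * 0) at_top"
    by (intro tendsto_diff tendsto_mult tendsto_const)
  then have lim: "((\<lambda>r. 1 - 2 * c * (1 / a) powr (1 / s) * r powr (- p / 4)) \<longlongrightarrow> 1) at_top" by simp
  have "\<forall>\<^sub>F r in at_top. (1 / c) powr s \<le> ln r"
    using ln_at_top by (auto simp: filterlim_at_top)
  then have ev: "\<forall>\<^sub>F r in at_top. r > 1 \<and> b r \<ge> 1"
    using eventually_gt_at_top[of 1]
  proof eventually_elim
    case (elim r)
    have "((1 / c) powr s) powr (1 / s) \<le> ln r powr (1 / s)"
      using elim s by (intro powr_mono2) auto
    then show ?case using elim s c by (simp add: b_def powr_powr field_simps)
  qed
  let ?P = "\<lambda>(x, y). prob {\<omega> \<in> space M. ereal (c * ln (eucl x y) powr \<Delta> \<beta>) \<le>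
        ereal_of_enat (graph_dist (sfp_graph L \<omega>) x y)}"
  have "(?P \<longlongrightarrow> 1) far_pairs"
  proof (rule tendsto_sandwich)
    let ?r = "\<lambda>(x, y). eucl x (y :: int ^ 'd)" and ?B = "\<lambda>r. 1 - 2 * c * (1 / a) powr (1 / s) * r powr (- p / 4)"
    show "((\<lambda>z. ?B (?r z)) \<longlongrightarrow> 1) far_pairs"
      using filterlim_compose[OF lim far] .
    have "\<forall>\<^sub>F z in far_pairs. ?r z > 1 \<and> b (?r z) \<ge> 1"
      using far ev by (auto simp only: filterlim_iff)
    then show "\<forall>\<^sub>F z in far_pairs. ?B (?r z) \<le> ?P z"
    proof eventually_elim
      case (elim z)
      obtain x y where z: "z = (x, y)" by (cases z)
      have "1 - (\<Sum>n<nat \<lceil>b (eucl x y)\<rceil>. decay p (R n) (eucl x y)) \<le>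
          prob {\<omega> \<in> space M. ereal (b (eucl x y)) \<le> ereal_of_enat (graph_dist (sfp_graph L \<omega>) x y)}"
        unfolding p_def by (rule prob_ge)
      then show ?case
        using elim bound[of "eucl x y"] bound'[of "eucl x y"]
        by (simp add: z b_def \<Delta> p_def)
    qed
  qed (auto intro!: always_eventually)
  then show ?thesis using c that by blast
qed

end

theorem corollary1p6:
  fixes M :: "'a measure"
    and W :: "int ^ 'd \<Rightarrow> 'a \<Rightarrow> real"
    and L :: "'a \<Rightarrow> (int ^ 'd) rel"
    and \<alpha> \<tau> l :: real
  assumes "scale_free_percolation M W L \<alpha> \<tau> l"
    and "1 < \<alpha>" and "\<alpha> < 2" and "\<tau> > 3" and "l > 0"
  shows "\<forall>\<^sub>F \<epsilon> in at_right 0. \<exists>c>0.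
    ((\<lambda>(x, y). measure M {\<omega> \<in> space M.
        ereal_of_enat (graph_dist (sfp_graph L \<omega>) x y)
          \<ge> ereal (c * ln (eucl x y) powr \<Delta> (min \<alpha> (\<tau> - 2 - \<epsilon>)))})
      \<longlongrightarrow> 1) far_pairs"
proof -
  interpret scale_free_percolation M W L \<alpha> \<tau> l by fact
  have "0 < min (\<alpha> - 1) ((\<tau> - 3) / 2)" using assms by simp
  then have "\<forall>\<^sub>F \<epsilon> in at_right 0. \<epsilon> \<in> {0 <..< min (\<alpha> - 1) ((\<tau> - 3) / 2)}"
    by (rule eventually_at_right_real)
  then show ?thesis
  proof eventually_elim
    case (elim \<epsilon>)
    \<comment> \<open>The \<open>\<epsilon>\<close> is split: half of it makes \<open>\<eta>\<close> summable, the other half keeps \<open>\<beta> + \<eta>\<close> below \<open>\<tau> - 1\<close>.\<close>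
    let ?\<beta> = "min \<alpha> (\<tau> - 2 - \<epsilon>)" and ?\<eta> = "1 + \<epsilon> / 2"
    have \<epsilon>: "0 < \<epsilon>" "\<epsilon> < \<alpha> - 1" "\<epsilon> < (\<tau> - 3) / 2" using elim by auto
    have "1 < ?\<beta>" "?\<beta> < 2" "?\<beta> \<le> \<alpha>" "1 < ?\<eta>" "?\<eta> \<le> ?\<beta>" "?\<beta> + ?\<eta> < \<tau> - 1"
      using \<epsilon> assms(2-4) by (auto simp: min_def)
    then show ?case by (rule graph_dist_lower_bound) blast
  qed
qed

end
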